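(* Let $C\in\mathbb D$ of dimension $n$, $N=rn$, and let $W$ be the differential operator $W(u)=|Wr(\phi_1,\dots,\phi_N,u)|$. Then (1) $W$ is a differential operator of order $N$ with polynomial coefficients (so it lies in the Weyl algebra); (2) the coefficient of $\partial^N$ in $W$ is a polynomial in $x$ of degree exactly $n$, so $W$ has a unique nonzero scalar multiple $\bar K_C$ whose coefficient of $\partial^N$ is a monic polynomial of degree $n$; (3) $\bar K_C^\flat$ also has order $N$ in $\partial$.
   Context: Fix an integer $r>1$ and constants $a_1,\dots,a_{r-2}\in\mathbb C$, and let $L_0=\partial^r-a_{r-2}\partial^{r-2}-\cdots-a_1\partial-x$, where $\partial=d/dx$. Fix a basis $f_1,\dots,f_r$ of $\ker L_0$ normalized so that $|Wr(f_1,\dots,f_r)|=1$. For a function $f$ of one variable write $\hat f(x,z)=f(x+z)$. $\mathcal S$ denotes the space of finitely supported distributions in the $z$-plane: finite linear combinations of $\delta_\lambda\circ\partial_z^j$, where $\delta_\lambda$ evaluates its argument at $z=\lambda$; applied to a function of $(x,z)$ such a distribution acts in $z$ and yields a function of $x$. $\mathbb D$ is the set of finite-dimensional subspaces $C\subset\mathcal S$ having a basis $c_i=\delta_{\lambda_i}\circ(\partial_z+\gamma_i)$, $i=1,\dots,n$ ($n\ge1$), with $\lambda_1,\dots,\lambda_n$ pairwise distinct and $\gamma_i\in\mathbb C$; for such $C$, $\phi_1,\dots,\phi_N$ ($N=rn$) are the functions $c_i(\hat f_j)$, $1\le i\le n$, $1\le j\le r$. $Wr(v_1,\dots,v_m)$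 is the $m\times m$ matrix whose first row is $(v_1,\dots,v_m)$ and each subsequent row is the derivative of the previous one; $|\cdot|$ is the determinant. The Weyl algebra is $\mathbb C[x]\langle\partial\rangle$; $\flat$ is the unique $\mathbb C$-linear anti-automorphism of the Weyl algebra with $x^\flat=L_0$, $\partial^\flat=\partial$ (equivalently $T(x,\partial_x)\hat f(x,z)=T^\flat(z,\partial_z)\hat f(x,z)$ for all $f\in\ker L_0$). *)

theory Defs
  imports "HOL-Analysis.Analysis" "HOL-Computational_Algebra.Polynomial"
begin

text \<open>An element of the Weyl algebra is represented in normal form
  T = sum_k p_k(x) d^k (coefficients on the left), as a polynomial in d whose
  coefficients are polynomials in x: coeff T k = p_k.  The order of T in d is
  degree T.\<close>

type_synonym weyl = "complex poly poly"

text \<open>Product in the Weyl algebra, via the Leibniz rule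
  d^i q = sum_l (i choose l) q^(l) d^(i-l).\<close>
definition wmult :: "weyl \<Rightarrow> weyl \<Rightarrow> weyl" where
  "wmult A B = (\<Sum>i\<le>degree A. \<Sum>j\<le>degree B. \<Sum>l\<le>i.
      monom (smult (of_nat (i choose l)) (coeff A i * (pderiv ^^ l) (coeff B j))) (i + j - l))"

fun wpow :: "weyl \<Rightarrow> nat \<Rightarrow> weyl" where
  "wpow A 0 = 1"
| "wpow A (Suc m) = wmult A (wpow A m)"

definition L0 :: "nat \<Rightarrow> (nat \<Rightarrow> complex) \<Rightarrow> weyl" where
  "L0 r a = monom 1 r - (\<Sum>k\<in>{1..r-2}. monom [:a k:] k) - [:[:0, 1:]:]"

text \<open>The anti-automorphism flat with x |-> L0, d |-> d:
  (p(x) d^k)^flat = d^k p(L0).\<close>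
definition wflat :: "nat \<Rightarrow> (nat \<Rightarrow> complex) \<Rightarrow> weyl \<Rightarrow> weyl" where
  "wflat r a T = (\<Sum>k\<le>degree T. wmult (monom 1 k)
      (\<Sum>m\<le>degree (coeff T k). smult [:coeff (coeff T k) m:] (wpow (L0 r a) m)))"

definition wapply :: "weyl \<Rightarrow> (complex \<Rightarrow> complex) \<Rightarrow> complex \<Rightarrow> complex" where
  "wapply T u x = (\<Sum>k\<le>degree T. poly (coeff T k) x * (deriv ^^ k) u x)"

definition det_nat :: "nat \<Rightarrow> (nat \<Rightarrow> nat \<Rightarrow> complex) \<Rightarrow> complex" where
  "det_nat m A = (\<Sum>p | p permutes {..<m}. of_int (sign p) * (\<Prod>i<m. A i (p i)))"

definition wronsk :: "(complex \<Rightarrow> complex) list \<Rightarrow> complex \<Rightarrow> complex" where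
  "wronsk vs x = det_nat (length vs) (\<lambda>i j. (deriv ^^ i) (vs ! j) x)"

definition in_ker_L0 :: "nat \<Rightarrow> (nat \<Rightarrow> complex) \<Rightarrow> (complex \<Rightarrow> complex) \<Rightarrow> bool" where
  "in_ker_L0 r a f \<longleftrightarrow> f holomorphic_on UNIV \<and>
     (\<forall>x. (deriv ^^ r) f x = (\<Sum>k\<in>{1..r-2}. a k * (deriv ^^ k) f x) + x * f x)"

text \<open>For c_i = delta_(lambda_i) o (d_z + gamma_i):  c_i(hat f)(x) = f'(x+lambda_i) + gamma_i f(x+lambda_i).
  The list phi_1..phi_N, ordered by (i,j) lexicographically.\<close>
definition phis :: "nat \<Rightarrow> nat \<Rightarrow> (nat \<Rightarrow> complex) \<Rightarrow> (nat \<Rightarrow> complex)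
    \<Rightarrow> (nat \<Rightarrow> complex \<Rightarrow> complex) \<Rightarrow> (complex \<Rightarrow> complex) list" where
  "phis n r lam gam f = concat (map (\<lambda>i. map (\<lambda>j. (\<lambda>x. deriv (f j) (x + lam i) + gam i * f j (x + lam i)))
        [0..<r]) [0..<n])"

end

theory Submission
  imports "Jordan_Normal_Form.Char_Poly" "HOL-Complex_Analysis.Cauchy_Integral_Formula" Defs
begin

text \<open>
  Both \<open>L\<close> and \<open>d\<close> act simply on \<open>u(x) = f'(x + lam) + gam f(x + lam)\<close>: since \<open>L f(x + lam) = lam f(x + lam)\<close>
  and \<open>[L, d] = 1\<close>, the function \<open>d^s L^q u\<close> is the combination
  \<open>lam^q f^(s+1) + (q lam^(q-1) + gam lam^q) f^(s)\<close> of the derivatives of \<open>f\<close> at \<open>x + lam\<close>, and \<open>x\<close> enters only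
  when \<open>f^(r)\<close> has to be reduced.  The operators \<open>d^s L^q\<close> with \<open>s < r\<close> are monic of order \<open>q r + s\<close>, so they may
  replace the rows \<open>d^m\<close> of the Wronskian, which then factors as an explicit polynomial matrix, bordered
  by the column of the \<open>d^s L^q u\<close>, times a block diagonal matrix of determinant one.  Thus
  \<open>W = sum m_(q,s)(x) d^s L^q\<close>, where the \<open>m_(q,s)\<close> are minors.  Only \<open>n\<close> rows of the matrix
  depend on \<open>x\<close>, linearly, so all minors have degree at most \<open>n\<close>, and the coefficient of \<open>x^n\<close> is a
  determinant that Vandermonde's argument shows to be nonzero for \<open>(q,s) = (n,0)\<close> and zero whenever \<open>s > 0\<close>.
  Finally flat turns \<open>m(x) d^s L^q\<close> into \<open>x^q d^s m(L)\<close>, whose order is below \<open>r n\<close> if \<open>s > 0\<close>; the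
  coefficient of \<open>d^(r n)\<close> is therefore a polynomial of degree exactly \<open>n\<close> in \<open>x\<close>.
\<close>

hide_const (open) Module.smult Finite_Cartesian_Product.mat Determinants.det Finite_Cartesian_Product.vec

section \<open>Left and right multiplication in the Weyl algebra\<close>

text \<open>Left multiplication by \<open>d\<close>: as \<open>d p d^k = p d^(k+1) + p' d^k\<close>,
  the shift raises the order and \<open>map_poly pderiv\<close> differentiates the coefficients. Its
  iterates replace the triple sum of \<open>wmult\<close>.\<close>

definition dmult :: "weyl \<Rightarrow> weyl" where
  "dmult B = pCons 0 B + map_poly pderiv B"

lemma coeff_dmult: "coeff (dmult B) k = coeff (pCons 0 B) k + pderiv (coeff B k)"
  by (simp add: dmult_def coeff_map_poly)

lemma dmult_add: "dmult (A + B) = dmult A + dmult B"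
  by (rule poly_eqI) (simp add: coeff_dmult coeff_pCons pderiv_add split: nat.split)

lemma dmult_0 [simp]: "dmult 0 = 0"
  by (simp add: dmult_def)

lemma dmult_minus: "dmult (- A) = - dmult A"
  by (rule poly_eqI) (simp add: coeff_dmult coeff_pCons pderiv_minus split: nat.split)

lemma dmult_smult_const: "dmult (smult [:c:] A) = smult [:c:] (dmult A)"
  by (rule poly_eqI) (simp add: coeff_dmult coeff_pCons pderiv_smult smult_add_right split: nat.split)

lemma dmult_smult_x: "dmult (smult [:0, 1:] A) = smult [:0, 1:] (dmult A) + A"
  by (rule poly_eqI) (simp add: coeff_dmult coeff_pCons pderiv_pCons algebra_simps split: nat.split)

lemma dmult_sum: "dmult (\<Sum>i\<in>S. g i) = (\<Sum>i\<in>S. dmult (g i))"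
  by (induction S rule: infinite_finite_induct) (simp_all add: dmult_add)

lemma dmult_pow_0 [simp]: "(dmult ^^ k) 0 = 0"
  by (induction k) auto

lemma dmult_pow_add: "(dmult ^^ k) (A + B) = (dmult ^^ k) A + (dmult ^^ k) B"
  by (induction k) (auto simp: dmult_add)

lemma dmult_pow_minus: "(dmult ^^ k) (- A) = - (dmult ^^ k) A"
  by (induction k) (auto simp: dmult_minus)

lemma dmult_pow_sum: "(dmult ^^ k) (\<Sum>i\<in>S. g i) = (\<Sum>i\<in>S. (dmult ^^ k) (g i))"
  by (induction k) (auto simp: dmult_sum)

lemma dmult_pow_smult_const: "(dmult ^^ k) (smult [:c:] A) = smult [:c:] ((dmult ^^ k) A)"
  by (induction k) (simp_all only: funpow.simps o_apply id_apply dmult_smult_const)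

text \<open>The commutation rule \<open>d^k x = x d^k + k d^(k-1)\<close>. At \<open>k = 0\<close>
  the truncated exponent is harmless because of the factor \<open>k\<close>.\<close>

lemma dmult_pow_smult_x:
  "(dmult ^^ k) (smult [:0, 1:] A) = smult [:0, 1:] ((dmult ^^ k) A) + of_nat k * (dmult ^^ (k - 1)) A"
proof (induction k)
  case (Suc k)
  have "of_nat k * B = smult [:of_nat k:] B" for B :: weyl
    by (rule poly_eqI) (simp add: of_nat_poly)
  hence "dmult (of_nat k * (dmult ^^ (k - 1)) A) = of_nat k * dmult ((dmult ^^ (k - 1)) A)"
    by (simp only: dmult_smult_const)
  also have "\<dots> = of_nat k * (dmult ^^ k) A" by (cases k) auto
  finally show ?case using Suc
    by (simp add: dmult_add dmult_smult_x algebra_simps del: mult_pCons_left smult_pCons)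
qed simp

text \<open>Differentiating coefficients never raises the order, so only the shift reaches the top.
  The bound \<open>d\<close> need not be attained; the coefficient there may vanish.\<close>

lemma coeff_dmult_pow_top:
  assumes "degree B \<le> d"
  shows "degree ((dmult ^^ k) B) \<le> k + d" "coeff ((dmult ^^ k) B) (k + d) = coeff B d"
proof (induction k)
  case (Suc k)
  case 1
  have "coeff ((dmult ^^ Suc k) B) j = 0" if "j > Suc k + d" for j
    using that Suc(1) coeff_eq_0[of "(dmult ^^ k) B" j] coeff_eq_0[of "(dmult ^^ k) B" "j - 1"]
    by (cases j) (auto simp: coeff_dmult)
  thus ?case by (metis degree_le)
  case 2
  show ?case using Suc coeff_eq_0[of "(dmult ^^ k) B" "Suc (k + d)"]
    by (auto simp: coeff_dmult)
qed (use assms in auto)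

text \<open>The Leibniz rule, by Pascal's identity; it identifies the inner sum of
  \<open>wmult\<close> with an iterate of \<open>dmult\<close>.\<close>

lemma dmult_pow_monom:
  "(dmult ^^ i) (monom q j) = (\<Sum>l\<le>i. monom (smult (of_nat (i choose l)) ((pderiv ^^ l) q)) (i + j - l))"
proof (induction i)
  case (Suc i)
  let ?c = "\<lambda>i l. monom (smult (of_nat (i choose l)) ((pderiv ^^ l) q)) (Suc i + j - l) :: weyl"
  have D: "dmult (monom p k) = monom p (Suc k) + monom (pderiv p) k" for p :: "complex poly" and k
    by (simp add: dmult_def map_poly_monom monom_Suc)
  have "(dmult ^^ Suc i) (monom q j) =
     (\<Sum>l\<le>i. monom (smult (of_nat (i choose l)) ((pderiv ^^ l) q)) (Suc (i + j - l))) +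
     (\<Sum>l\<le>i. monom (smult (of_nat (i choose l)) ((pderiv ^^ Suc l) q)) (i + j - l))"
    by (simp add: Suc dmult_sum D sum.distrib pderiv_smult)
  \<comment> \<open>The added term \<open>l = Suc i\<close> is zero because its binomial coefficient
    is.\<close>
  also have "(\<Sum>l\<le>i. monom (smult (of_nat (i choose l)) ((pderiv ^^ l) q)) (Suc (i + j - l)))
     = (\<Sum>l\<le>Suc i. monom (smult (of_nat (i choose l)) ((pderiv ^^ l) q)) (Suc i + j - l))"
    by (simp add: Suc_diff_le)
  also have "\<dots> = monom q (Suc i + j) + 
     (\<Sum>l\<le>i. monom (smult (of_nat (i choose Suc l)) ((pderiv ^^ Suc l) q)) (i + j - l))"
    by (subst sum.atMost_Suc_shift) simp
  also have "\<dots> + (\<Sum>l\<le>i. monom (smult (of_nat (i choose l)) ((pderiv ^^ Suc l) q)) (i + j - l))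
    = monom q (Suc i + j) + (\<Sum>l\<le>i. monom (smult (of_nat (Suc i choose Suc l)) ((pderiv ^^ Suc l) q)) (i + j - l))"
    by (simp add: sum.distrib [symmetric] add_monom smult_add_left [symmetric] add.commute)
  also have "\<dots> = (\<Sum>l\<le>Suc i. monom (smult (of_nat (Suc i choose l)) ((pderiv ^^ l) q)) (Suc i + j - l))"
    by (subst sum.atMost_Suc_shift) simp
  finally show ?case .
qed simp

lemma wmult_eq: "wmult A B = (\<Sum>i\<le>degree A. smult (coeff A i) ((dmult ^^ i) B))"
proof -
  have "(dmult ^^ i) B = (\<Sum>j\<le>degree B. \<Sum>l\<le>i. 
      monom (smult (of_nat (i choose l)) ((pderiv ^^ l) (coeff B j))) (i + j - l))" for i
    by (subst poly_as_sum_of_monoms [of B, symmetric])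
       (simp only: dmult_pow_sum dmult_pow_monom)
  thus ?thesis
    by (simp add: wmult_def smult_sum2 smult_monom)
qed

lemma wmult_monom_1: "wmult (monom 1 k) B = (dmult ^^ k) B"
proof -
  have "wmult (monom 1 k) B = (\<Sum>i\<le>k. if i = k then (dmult ^^ k) B else 0)"
    unfolding wmult_eq by (intro sum.cong) (auto simp: degree_monom_eq)
  thus ?thesis by simp
qed

section \<open>Left multiplication by \<open>L0\<close> and the order of its powers\<close>

lemma coeff_L0:
  assumes "r > 1"
  shows "coeff (L0 r a) k = (if k = r then 1 else 0) - (if k \<in> {1..r-2} then [:a k:] else 0)
     - (if k = 0 then [:0, 1:] else 0)"
proof -
  have "coeff (\<Sum>i\<in>{1..r-2}. monom [:a i:] i) k = (if k \<in> {1..r-2} then [:a k:] else 0)"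
    by (simp add: coeff_sum)
  thus ?thesis by (auto simp: L0_def coeff_pCons split: nat.split)
qed

lemma degree_L0:
  assumes "r > 1"
  shows "degree (L0 r a) = r" and lead_coeff_L0: "coeff (L0 r a) r = 1"
proof -
  show *: "coeff (L0 r a) r = 1" using assms by (auto simp: coeff_L0)
  show "degree (L0 r a) = r"
    using assms * by (intro antisym degree_le le_degree) (auto simp: coeff_L0)
qed

lemma wmult_L0:
  assumes "r > 1"
  shows "wmult (L0 r a) B = (dmult ^^ r) B - (\<Sum>k\<in>{1..r-2}. smult [:a k:] ((dmult ^^ k) B)) - smult [:0, 1:] B"
proof -
  have "wmult (L0 r a) B = (\<Sum>i\<le>r. (if i = r then (dmult ^^ i) B else 0)
     - (if i \<in> {1..r-2} then smult [:a i:] ((dmult ^^ i) B) else 0) - (if i = 0 then smult [:0, 1:] B else 0))"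
    unfolding wmult_eq degree_L0[OF assms]
    using assms by (intro sum.cong) (auto simp: coeff_L0 smult_diff_left)
  also have "\<dots> = (dmult ^^ r) B - (\<Sum>i\<le>r. if i \<in> {1..r-2} then smult [:a i:] ((dmult ^^ i) B) else 0)
     - smult [:0, 1:] B"
    by (simp add: sum_subtractf)
  also have "(\<Sum>i\<le>r. if i \<in> {1..r-2} then smult [:a i:] ((dmult ^^ i) B) else 0)
     = (\<Sum>i\<in>{1..r-2}. smult [:a i:] ((dmult ^^ i) B))"
    by (intro sum.mono_neutral_cong_right) auto
  finally show ?thesis .
qed

lemma wmult_sum_right: "wmult A (\<Sum>i\<in>S. g i) = (\<Sum>i\<in>S. wmult A (g i))"
  by (simp add: wmult_eq dmult_pow_sum smult_sum2 sum.swap [of _ _ S])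

lemma wmult_smult_const_right: "wmult A (smult [:c:] B) = smult [:c:] (wmult A B)"
  by (simp add: wmult_eq dmult_pow_smult_const smult_sum2 mult.commute)

text \<open>Beside \<open>d^r\<close>, \<open>L0\<close> contains only \<open>d\<close>-powers up to
  \<open>r - 2\<close> and \<open>x\<close>; none of these lifts \<open>B\<close> to order
  \<open>r + d\<close>.\<close>

lemma coeff_wmult_L0_top:
  assumes r: "r > 1" and d: "degree B \<le> d"
  shows "degree (wmult (L0 r a) B) \<le> r + d" "coeff (wmult (L0 r a) B) (r + d) = coeff B d"
proof -
  have *: "coeff ((dmult ^^ k) B) j = 0" if "j > k + d" for k j
    using coeff_dmult_pow_top(1)[OF d, of k] that by (intro coeff_eq_0) auto
  have c: "coeff (wmult (L0 r a) B) j = coeff ((dmult ^^ r) B) j" if "j \<ge> r + d" for j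
  proof -
    have "coeff B j = 0" using r d that by (intro coeff_eq_0) auto
    moreover have "coeff ((dmult ^^ k) B) j = 0" if "k \<in> {1..r-2}" for k
      using that \<open>j \<ge> r + d\<close> by (intro *) auto
    ultimately show ?thesis
      by (simp add: wmult_L0[OF r] coeff_sum)
  qed
  show "coeff (wmult (L0 r a) B) (r + d) = coeff B d"
    using c[of "r + d"] coeff_dmult_pow_top(2)[OF d, of r] by simp
  show "degree (wmult (L0 r a) B) \<le> r + d"
    using c * by (intro degree_le) auto
qed

lemma wpow_L0_top:
  assumes r: "r > 1"
  shows "degree (wpow (L0 r a) m) \<le> r * m" "coeff (wpow (L0 r a) m) (r * m) = 1"
  by (induction m) (auto dest: coeff_wmult_L0_top[OF r])

section \<open>Polynomials in \<open>L0\<close> and the map flat\<close>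

definition eval_L0 :: "nat \<Rightarrow> (nat \<Rightarrow> complex) \<Rightarrow> complex poly \<Rightarrow> weyl" where
  "eval_L0 r a p = (\<Sum>m\<le>degree p. smult [:coeff p m:] (wpow (L0 r a) m))"

lemma eval_L0_altdef:
  assumes "degree p \<le> d"
  shows "eval_L0 r a p = (\<Sum>m\<le>d. smult [:coeff p m:] (wpow (L0 r a) m))"
  unfolding eval_L0_def using assms by (intro sum.mono_neutral_left) (auto simp: coeff_eq_0)

lemma eval_L0_add: "eval_L0 r a (p + q) = eval_L0 r a p + eval_L0 r a q"
proof -
  define d where "d = max (degree p) (degree q)"
  have "degree p \<le> d" "degree q \<le> d" "degree (p + q) \<le> d"
    by (auto simp: d_def degree_add_le_max)
  thus ?thesis
    by (simp add: eval_L0_altdef [of _ d] sum.distrib [symmetric] smult_add_left [symmetric])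
qed

lemma eval_L0_0 [simp]: "eval_L0 r a 0 = 0"
  by (simp add: eval_L0_def)

lemma eval_L0_smult: "eval_L0 r a (smult c p) = smult [:c:] (eval_L0 r a p)"
  by (subst eval_L0_altdef[of _ "degree p"]) (auto simp: eval_L0_def smult_sum2 mult.commute)

lemma eval_L0_x: "eval_L0 r a (pCons 0 p) = wmult (L0 r a) (eval_L0 r a p)"
proof -
  have "eval_L0 r a (pCons 0 p) = (\<Sum>m\<le>Suc (degree p). smult [:coeff (pCons 0 p) m:] (wpow (L0 r a) m))"
    by (rule eval_L0_altdef) (rule degree_pCons_le)
  also have "\<dots> = (\<Sum>m\<le>degree p. smult [:coeff p m:] (wmult (L0 r a) (wpow (L0 r a) m)))"
    by (subst sum.atMost_Suc_shift) simp
  finally show ?thesis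
    by (simp add: eval_L0_def wmult_sum_right wmult_smult_const_right)
qed

text \<open>Since \<open>L0^m\<close> has order at most \<open>r * m\<close> and is monic there,
  only the term \<open>m = n\<close> reaches order \<open>r * n\<close>.\<close>

lemma eval_L0_top:
  assumes r: "r > 1" and p: "degree p \<le> n"
  shows "degree (eval_L0 r a p) \<le> r * n" "coeff (eval_L0 r a p) (r * n) = [:coeff p n:]"
proof -
  have *: "degree (wpow (L0 r a) m) \<le> r * n" if "m \<le> n" for m
    using wpow_L0_top(1)[OF r, of a m] that by (meson le_trans mult_le_mono2)
  show "degree (eval_L0 r a p) \<le> r * n"
    unfolding eval_L0_altdef[OF p]
    by (intro degree_sum_le) (auto intro: *)
  have "coeff (wpow (L0 r a) m) (r * n) = 0" if "m < n" for m
    using wpow_L0_top(1)[OF r, of a m] r that by (intro coeff_eq_0) (auto intro: le_less_trans)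
  hence "coeff (eval_L0 r a p) (r * n) = (\<Sum>m\<le>n. if m = n then [:coeff p m:] else 0)"
    unfolding eval_L0_altdef[OF p] coeff_sum using wpow_L0_top(2)[OF r]
    by (intro sum.cong) auto
  thus "coeff (eval_L0 r a p) (r * n) = [:coeff p n:]" by simp
qed

lemma wflat_altdef:
  assumes "degree T \<le> d"
  shows "wflat r a T = (\<Sum>k\<le>d. (dmult ^^ k) (eval_L0 r a (coeff T k)))"
  unfolding wflat_def eval_L0_def [symmetric] wmult_monom_1
  using assms by (intro sum.mono_neutral_left) (auto simp: coeff_eq_0)

lemma wflat_0 [simp]: "wflat r a 0 = 0"
  by (simp add: wflat_altdef[of _ 0])

lemma wflat_add: "wflat r a (S + T) = wflat r a S + wflat r a T"
proof -
  define d where "d = max (degree S) (degree T)"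
  have "degree S \<le> d" "degree T \<le> d" "degree (S + T) \<le> d"
    by (auto simp: d_def degree_add_le_max)
  thus ?thesis
    by (simp add: wflat_altdef [of _ d] sum.distrib [symmetric] eval_L0_add dmult_pow_add)
qed

lemma wflat_smult_const: "wflat r a (smult [:c:] T) = smult [:c:] (wflat r a T)"
  by (subst wflat_altdef[of _ "degree T"])
     (simp_all add: wflat_altdef[of T "degree T"] eval_L0_smult dmult_pow_smult_const smult_sum2)

lemma wflat_minus: "wflat r a (- T) = - wflat r a T"
  by (rule minus_unique [symmetric]) (simp add: wflat_add [symmetric])

lemma wflat_diff: "wflat r a (S - T) = wflat r a S - wflat r a T"
  using wflat_add[of r a S "- T"] by (simp add: wflat_minus)

lemma wflat_sum: "wflat r a (\<Sum>i\<in>S. g i) = (\<Sum>i\<in>S. wflat r a (g i))"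
  by (induction S rule: infinite_finite_induct) (simp_all add: wflat_add)

lemma wflat_monom: "wflat r a (monom p k) = (dmult ^^ k) (eval_L0 r a p)"
proof -
  have "wflat r a (monom p k) = (\<Sum>i\<le>k. if i = k then (dmult ^^ k) (eval_L0 r a p) else 0)"
    unfolding wflat_altdef[OF degree_monom_le] by (rule sum.cong) auto
  thus ?thesis by simp
qed

text \<open>Right multiplication by \<open>L0\<close> in the Weyl algebra: \<open>*\<close> is the commutative product of symbols, and the
  correction comes from \<open>d^k x = x d^k + k d^(k-1)\<close>, \<open>pderiv\<close> differentiating in \<open>d\<close>.\<close>

definition rmult_L0 :: "nat \<Rightarrow> (nat \<Rightarrow> complex) \<Rightarrow> weyl \<Rightarrow> weyl" where
  "rmult_L0 r a T = T * L0 r a - pderiv T"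

lemma rmult_L0_sum: "rmult_L0 r a (\<Sum>i\<in>S. g i) = (\<Sum>i\<in>S. rmult_L0 r a (g i))"
  by (simp add: rmult_L0_def sum_distrib_right pderiv_sum sum_subtractf)

lemma rmult_L0_monom:
  "rmult_L0 r a (monom p s) = monom p (s + r) - (\<Sum>k\<in>{1..r-2}. monom (smult (a k) p) (s + k))
      - monom (pCons 0 p) s - monom (of_nat s * p) (s - 1)"
  by (simp add: rmult_L0_def L0_def algebra_simps sum_distrib_left mult_monom pderiv_monom
      smult_monom of_nat_poly flip: monom_0)
     (simp add: monom_0 mult.commute)

text \<open>Flat reverses products and sends \<open>L0\<close> to
  \<open>d^r - sum a_k d^k - L0 = x\<close>, so a right factor \<open>L0\<close> becomes a left
  factor \<open>x\<close>.\<close>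

lemma wflat_rmult_L0:
  assumes r: "r > 1"
  shows "wflat r a (rmult_L0 r a T) = smult [:0, 1:] (wflat r a T)"
proof -
  have M: "wflat r a (rmult_L0 r a (monom p s)) = smult [:0, 1:] (wflat r a (monom p s))" for p s
  proof -
    define E where "E = eval_L0 r a p"
    have "of_nat s * p = smult (of_nat s) p" by (simp add: of_nat_poly)
    hence "wflat r a (rmult_L0 r a (monom p s)) = (dmult ^^ s) ((dmult ^^ r) E)
       - (\<Sum>k\<in>{1..r-2}. (dmult ^^ s) (smult [:a k:] ((dmult ^^ k) E)))
       - (dmult ^^ s) (wmult (L0 r a) E) - smult [:of_nat s:] ((dmult ^^ (s - 1)) E)"
      by (simp add: rmult_L0_monom wflat_diff wflat_sum wflat_monom eval_L0_smult eval_L0_x E_def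
          dmult_pow_smult_const funpow_add)
    \<comment> \<open>Expanding \<open>L0 E\<close> cancels the terms with \<open>d^r\<close> and
      \<open>a k\<close> and leaves \<open>x E\<close>.\<close>
    also have "\<dots> = (dmult ^^ s) (smult [:0, 1:] E) - smult [:of_nat s:] ((dmult ^^ (s - 1)) E)"
      by (simp add: wmult_L0[OF r] dmult_pow_add dmult_pow_minus dmult_pow_sum diff_conv_add_uminus
          del: add_uminus_conv_diff)
    also have "smult [:of_nat s:] ((dmult ^^ (s - 1)) E) = of_nat s * (dmult ^^ (s - 1)) E"
      by (simp add: of_nat_poly)
    \<comment> \<open>The correction from right multiplication by \<open>L0\<close> is exactly the
      commutator of \<open>d^s\<close> and \<open>x\<close>.\<close>
    also have "(dmult ^^ s) (smult [:0, 1:] E) - of_nat s * (dmult ^^ (s - 1)) E = smult [:0, 1:] ((dmult ^^ s) E)"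
      by (simp only: dmult_pow_smult_x) simp
    finally show ?thesis by (simp add: wflat_monom E_def)
  qed
  show ?thesis
    by (subst (1 2) poly_as_sum_of_monoms [of T, symmetric])
       (simp only: rmult_L0_sum wflat_sum M smult_sum2)
qed

lemma wflat_rmult_L0_pow:
  assumes r: "r > 1"
  shows "wflat r a ((rmult_L0 r a ^^ q) T) = smult ([:0, 1:] ^ q) (wflat r a T)"
  by (induction q) (simp_all only: funpow.simps o_apply id_apply wflat_rmult_L0[OF r] smult_smult power_Suc power_0 smult_1_left)

lemma coeff_mult_top:
  fixes p q :: "'a :: comm_semiring_0 poly"
  assumes p: "degree p \<le> m" and q: "degree q \<le> n"
  shows "coeff (p * q) (m + n) = coeff p m * coeff q n"
proof -
  have "coeff p i * coeff q (m + n - i) = 0" if "i \<le> m + n" "i \<noteq> m" for i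
    using that p q by (cases "i < m") (auto simp: coeff_eq_0)
  hence "coeff (p * q) (m + n) = (\<Sum>i\<le>m+n. if i = m then coeff p m * coeff q n else 0)"
    unfolding coeff_mult by (intro sum.cong) auto
  thus ?thesis by simp
qed

text \<open>The correction \<open>pderiv\<close> lowers the order, so the top is that of the product
  of symbols, where \<open>L0\<close> is monic of order \<open>r\<close>.\<close>

lemma rmult_L0_pow_top:
  assumes r: "r > 1" and d: "degree T \<le> d"
  shows "degree ((rmult_L0 r a ^^ q) T) \<le> q * r + d" "coeff ((rmult_L0 r a ^^ q) T) (q * r + d) = coeff T d"
proof (induction q)
  case (Suc q)
  let ?S = "(rmult_L0 r a ^^ q) T"
  have p: "degree (pderiv ?S) \<le> q * r + d"
    using Suc(1) degree_pderiv_le[of ?S] by linarith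
  have m: "degree (?S * L0 r a) \<le> q * r + d + r"
    using Suc(1) degree_mult_le[of ?S "L0 r a"] degree_L0[OF r] by simp
  case 1
  show ?case using p m by (auto simp: rmult_L0_def [of r a "(rmult_L0 r a ^^ q) T"] intro!: degree_diff_le)
  case 2
  have "coeff (pderiv ?S) (q * r + d + r) = 0" using p r by (intro coeff_eq_0) auto
  moreover have "coeff (?S * L0 r a) (q * r + d + r) = coeff ?S (q * r + d) * coeff (L0 r a) r"
    using Suc(1) degree_L0[OF r] by (intro coeff_mult_top) auto
  ultimately show ?case using Suc(2) lead_coeff_L0[OF r] by (simp add: rmult_L0_def [of r a ?S] add_ac)
qed (use d in auto)

section \<open>Action on entire functions\<close>

definition L0_fun :: "nat \<Rightarrow> (nat \<Rightarrow> complex) \<Rightarrow> (complex \<Rightarrow> complex) \<Rightarrow> complex \<Rightarrow> complex" where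
  "L0_fun r a u x = (deriv ^^ r) u x - (\<Sum>k\<in>{1..r-2}. a k * (deriv ^^ k) u x) - x * u x"

lemma entire_higher_deriv: "u holomorphic_on UNIV \<Longrightarrow> (deriv ^^ k) u holomorphic_on UNIV"
  by (rule holomorphic_higher_deriv) auto

lemma entire_L0_fun: "u holomorphic_on UNIV \<Longrightarrow> L0_fun r a u holomorphic_on UNIV"
  unfolding L0_fun_def [abs_def] by (intro holomorphic_intros entire_higher_deriv)

lemma higher_deriv_lincomb:
  assumes "\<And>i. i \<in> S \<Longrightarrow> g i holomorphic_on UNIV"
  shows "(deriv ^^ k) (\<lambda>x. \<Sum>i\<in>S. c i * g i x) = (\<lambda>x. \<Sum>i\<in>S. c i * (deriv ^^ k) (g i) x :: complex)"
  using assms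
proof (induction S rule: infinite_finite_induct)
  case (insert i S)
  have "(deriv ^^ k) (\<lambda>x. c i * g i x + (\<Sum>i\<in>S. c i * g i x)) x
      = c i * (deriv ^^ k) (g i) x + (\<Sum>i\<in>S. c i * (deriv ^^ k) (g i) x)" for x
    using insert.prems insert.IH
    by (subst higher_deriv_add [of _ UNIV])
       (auto intro!: holomorphic_intros simp: higher_deriv_cmult [of _ UNIV])
  thus ?case using insert by (simp add: fun_eq_iff)
qed (auto simp: fun_eq_iff)

lemma higher_deriv_lincomb2:
  assumes "u holomorphic_on UNIV" "v holomorphic_on UNIV"
  shows "(deriv ^^ k) (\<lambda>x. c * u x + d * v x) = (\<lambda>x. c * (deriv ^^ k) u x + d * (deriv ^^ k) v x :: complex)"
  using assms
  by (intro ext, subst higher_deriv_add [of _ UNIV])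
     (auto intro!: holomorphic_intros simp: higher_deriv_cmult [of _ UNIV])

lemma higher_deriv_x_times:
  assumes u: "u holomorphic_on UNIV"
  shows "(deriv ^^ k) (\<lambda>x. x * u x) = (\<lambda>x. x * (deriv ^^ k) u x + of_nat k * (deriv ^^ (k - 1)) u x)"
proof (induction k)
  case (Suc k)
  have *: "((deriv ^^ j) u has_field_derivative (deriv ^^ Suc j) u x) (at x)" for j x
    using entire_higher_deriv[OF u, of j]
    by (simp add: holomorphic_derivI)
  have "of_nat k * (deriv ^^ Suc (k - 1)) u x = of_nat k * (deriv ^^ k) u x" for x
    by (cases k) auto
  hence "((\<lambda>x. x * (deriv ^^ k) u x + of_nat k * (deriv ^^ (k - 1)) u x) has_field_derivative
      (x * (deriv ^^ Suc k) u x + of_nat (Suc k) * (deriv ^^ k) u x)) (at x)" for x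
    by (auto intro!: derivative_eq_intros * simp: algebra_simps)
  thus ?case by (auto simp: Suc fun_eq_iff intro!: DERIV_imp_deriv)
qed auto

lemma higher_deriv_L0_fun:
  assumes u: "u holomorphic_on UNIV"
  shows "(deriv ^^ k) (L0_fun r a u) x = (deriv ^^ (k + r)) u x - (\<Sum>l\<in>{1..r-2}. a l * (deriv ^^ (k + l)) u x)
      - x * (deriv ^^ k) u x - of_nat k * (deriv ^^ (k - 1)) u x"
proof -
  have "(deriv ^^ k) (L0_fun r a u) x = (deriv ^^ k) ((deriv ^^ r) u) x
     - (deriv ^^ k) (\<lambda>x. \<Sum>l\<in>{1..r-2}. a l * (deriv ^^ l) u x) x - (deriv ^^ k) (\<lambda>x. x * u x) x"
    unfolding L0_fun_def [abs_def]
    by (subst higher_deriv_diff [of _ UNIV] | intro holomorphic_intros entire_higher_deriv u open_UNIV UNIV_I refl)+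
  also have "(deriv ^^ k) (\<lambda>x. \<Sum>l\<in>{1..r-2}. a l * (deriv ^^ l) u x) x = (\<Sum>l\<in>{1..r-2}. a l * (deriv ^^ k) ((deriv ^^ l) u) x)"
    by (subst higher_deriv_lincomb) (auto intro: entire_higher_deriv u)
  finally show ?thesis
    unfolding higher_deriv_x_times[OF u] funpow_add o_apply by (simp add: algebra_simps)
qed

lemma L0_fun_lincomb:
  assumes "u holomorphic_on UNIV" "v holomorphic_on UNIV"
  shows "L0_fun r a (\<lambda>x. c * u x + d * v x) = (\<lambda>x. c * L0_fun r a u x + d * L0_fun r a v x)"
  by (rule ext, simp add: L0_fun_def higher_deriv_lincomb2[OF assms] algebra_simps sum.distrib sum_distrib_left)

text \<open>This is \<open>[L0, d] = 1\<close>: only the summand \<open>-x\<close> of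
  \<open>L0\<close> fails to commute with \<open>d\<close>.\<close>

lemma L0_fun_deriv:
  assumes "u holomorphic_on UNIV"
  shows "L0_fun r a (deriv u) x = deriv (L0_fun r a u) x + u x"
  using higher_deriv_L0_fun[OF assms, of 1 r a x]
  by (simp add: L0_fun_def [of r a "deriv u"] funpow_swap1)

section \<open>Normal-form operators acting on entire functions\<close>

lemma wapply_altdef:
  assumes "degree T \<le> d"
  shows "wapply T u x = (\<Sum>k\<le>d. poly (coeff T k) x * (deriv ^^ k) u x)"
  unfolding wapply_def using assms by (intro sum.mono_neutral_left) (auto simp: coeff_eq_0)

lemma wapply_0 [simp]: "wapply 0 u x = 0"
  by (simp add: wapply_def)

lemma wapply_add: "wapply (S + T) u x = wapply S u x + wapply T u x"
proof -
  define d where "d = max (degree S) (degree T)"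
  have "degree S \<le> d" "degree T \<le> d" "degree (S + T) \<le> d"
    by (auto simp: d_def degree_add_le_max)
  thus ?thesis by (simp add: wapply_altdef [of _ d] sum.distrib algebra_simps)
qed

lemma wapply_diff: "wapply (S - T) u x = wapply S u x - wapply T u x"
  using wapply_add [of "S - T" T u x] by simp

lemma wapply_sum: "wapply (\<Sum>i\<in>S. g i) u x = (\<Sum>i\<in>S. wapply (g i) u x)"
  by (induction S rule: infinite_finite_induct) (simp_all add: wapply_add)

lemma wapply_monom: "wapply (monom p k) u x = poly p x * (deriv ^^ k) u x"
proof -
  have "wapply (monom p k) u x = (\<Sum>i\<le>k. if i = k then poly p x * (deriv ^^ k) u x else 0)"
    unfolding wapply_altdef[OF degree_monom_le] by (rule sum.cong) auto
  thus ?thesis by simp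
qed

text \<open>Confirms that \<open>rmult_L0\<close> is composition with \<open>L0\<close> on the
  right: the derivatives of \<open>L0 u\<close> contain the same correction term.\<close>

lemma wapply_rmult_L0:
  assumes u: "u holomorphic_on UNIV"
  shows "wapply (rmult_L0 r a T) u x = wapply T (L0_fun r a u) x"
proof -
  have M: "wapply (rmult_L0 r a (monom p s)) u x = wapply (monom p s) (L0_fun r a u) x" for p s
    unfolding rmult_L0_monom wapply_diff wapply_sum wapply_monom higher_deriv_L0_fun[OF u]
    by (simp add: algebra_simps sum_distrib_left)
  show ?thesis
    by (subst (1 2) poly_as_sum_of_monoms [of T, symmetric])
       (simp only: rmult_L0_sum wapply_sum M)
qed

lemma wapply_rmult_L0_pow:
  assumes u: "u holomorphic_on UNIV"
  shows "wapply ((rmult_L0 r a ^^ q) T) u x = wapply T ((L0_fun r a ^^ q) u) x"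
  using u
\<comment> \<open>The outermost right factor \<open>L0\<close> acts on \<open>u\<close> first, hence
  \<open>u\<close> varies.\<close>
proof (induction q arbitrary: u)
  case (Suc q)
  have "wapply ((rmult_L0 r a ^^ Suc q) T) u x = wapply ((rmult_L0 r a ^^ q) T) (L0_fun r a u) x"
    by (simp add: wapply_rmult_L0 Suc.prems)
  also have "\<dots> = wapply T ((L0_fun r a ^^ q) (L0_fun r a u)) x"
    by (intro Suc.IH entire_L0_fun Suc.prems)
  finally show ?case by (simp add: funpow_swap1)
qed simp

section \<open>Translates of kernel functions\<close>

lemma higher_deriv_shift:
  assumes "f holomorphic_on UNIV"
  shows "(deriv ^^ k) (\<lambda>x. f (x + c)) = (\<lambda>x. (deriv ^^ k) f (x + c :: complex))"
  using higher_deriv_compose_linear'[of f UNIV UNIV _ 1 c k] assms by (auto simp: fun_eq_iff)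

text \<open>Translating the equation \<open>L0 f = 0\<close> changes only the term
  \<open>x f\<close>, by the constant \<open>lam\<close>.\<close>

lemma L0_fun_shift:
  assumes "in_ker_L0 r a f"
  shows "L0_fun r a (\<lambda>x. f (x + lam)) = (\<lambda>x. lam * f (x + lam))"
proof
  fix x
  have f: "f holomorphic_on UNIV" and
    "(deriv ^^ r) f (x + lam) = (\<Sum>k\<in>{1..r-2}. a k * (deriv ^^ k) f (x + lam)) + (x + lam) * f (x + lam)"
    using assms by (auto simp: in_ker_L0_def)
  thus "L0_fun r a (\<lambda>x. f (x + lam)) x = lam * f (x + lam)"
    by (simp add: L0_fun_def higher_deriv_shift[OF f] algebra_simps)
qed

text \<open>The value at \<open>z = lam\<close> of \<open>(d/dz + gam) z^q\<close>.\<close>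

definition bcoef :: "complex \<Rightarrow> complex \<Rightarrow> nat \<Rightarrow> complex" where
  "bcoef lam gam q = of_nat q * lam ^ (q - 1) + gam * lam ^ q"

text \<open>Commuting \<open>L0\<close> past \<open>d + gam\<close> amounts to differentiating \<open>z ^ q * f (x + z)\<close> in \<open>z\<close>.\<close>

lemma L0_fun_pow_darboux:
  assumes f: "in_ker_L0 r a f"
  shows "(L0_fun r a ^^ q) (\<lambda>x. deriv f (x + lam) + gam * f (x + lam)) =
    (\<lambda>x. lam ^ q * deriv f (x + lam) + bcoef lam gam q * f (x + lam))"
proof (induction q)
  case (Suc q)
  have hol: "f holomorphic_on UNIV" using f by (simp add: in_ker_L0_def)
  hence g: "(\<lambda>x. f (x + lam)) holomorphic_on UNIV"
    by (auto intro!: holomorphic_on_compose_gen [of _ _ f UNIV, unfolded o_def] holomorphic_intros)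
  have dg: "deriv (\<lambda>x. f (x + lam)) = (\<lambda>x. deriv f (x + lam))"
    using higher_deriv_shift[OF hol, of 1] by simp
  \<comment> \<open>The extra \<open>f (x + lam)\<close> from \<open>[L0, d] = 1\<close> builds up
    the derivative of \<open>z^q\<close>.\<close>
  have Ldg: "L0_fun r a (\<lambda>x. deriv f (x + lam)) = (\<lambda>x. lam * deriv f (x + lam) + f (x + lam))"
  proof
    fix x
    have "L0_fun r a (deriv (\<lambda>x. f (x + lam))) x = deriv (\<lambda>x. lam * f (x + lam)) x + f (x + lam)"
      using L0_fun_deriv[OF g] L0_fun_shift[OF f] by simp
    moreover have "deriv (\<lambda>x. lam * f (x + lam)) x = lam * deriv (\<lambda>x. f (x + lam)) x"
      using g by (intro deriv_cmult) (auto simp: holomorphic_on_imp_differentiable_at)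
    ultimately show "L0_fun r a (\<lambda>x. deriv f (x + lam)) x = lam * deriv f (x + lam) + f (x + lam)"
      by (simp add: dg)
  qed
  have "(\<lambda>x. deriv f (x + lam)) holomorphic_on UNIV"
    using entire_higher_deriv[OF g, of 1] dg by simp
  hence "L0_fun r a (\<lambda>x. lam ^ q * deriv f (x + lam) + bcoef lam gam q * f (x + lam)) =
     (\<lambda>x. lam ^ q * (lam * deriv f (x + lam) + f (x + lam)) + bcoef lam gam q * (lam * f (x + lam)))"
    using g by (subst L0_fun_lincomb) (simp_all add: L0_fun_shift[OF f] Ldg)
  moreover have "bcoef lam gam (Suc q) = lam ^ q + bcoef lam gam q * lam"
    by (cases q) (simp_all add: bcoef_def algebra_simps)
  ultimately show ?case using Suc by (simp add: algebra_simps)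
qed (auto simp: bcoef_def)

text \<open>The coefficients, on \<open>d^k\<close> with \<open>k < r\<close>, of \<open>d^s L0^q (d + gam)\<close> modulo the left ideal of the operator
  \<open>L0 - lam\<close> annihilating the functions \<open>f(x + lam)\<close>.\<close>

definition qentry :: "nat \<Rightarrow> (nat \<Rightarrow> complex) \<Rightarrow> complex \<Rightarrow> complex \<Rightarrow> nat \<Rightarrow> nat \<Rightarrow> nat \<Rightarrow> complex poly" where
  "qentry r a lam gam q s k = (if k = s then [:bcoef lam gam q:] else 0) +
     smult (lam ^ q) (if Suc s < r then (if k = Suc s then 1 else 0)
        else (if k = 0 then [:lam, 1:] else 0) + (if k \<in> {1..r-2} then [:a k:] else 0))"

text \<open>For \<open>s < r - 1\<close> only derivatives of order below \<open>r\<close> occur. For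
  \<open>s = r - 1\<close> the differential equation reduces the \<open>r\<close>-th derivative, and
  this is the only source of \<open>x\<close>, in the entry \<open>k = 0\<close>.\<close>

lemma higher_deriv_L0_fun_pow_darboux:
  assumes f: "in_ker_L0 r a f" and s: "s < r"
  shows "(deriv ^^ s) ((L0_fun r a ^^ q) (\<lambda>x. deriv f (x + lam) + gam * f (x + lam))) x =
    (\<Sum>k<r. poly (qentry r a lam gam q s k) x * (deriv ^^ k) f (x + lam))"
proof -
  let ?F = "\<lambda>k. (deriv ^^ k) f (x + lam)"
  have hol: "f holomorphic_on UNIV" using f by (simp add: in_ker_L0_def)
  hence g: "(\<lambda>x. f (x + lam)) holomorphic_on UNIV"
    by (auto intro!: holomorphic_on_compose_gen [of _ _ f UNIV, unfolded o_def] holomorphic_intros)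
  have dg: "(\<lambda>x. deriv f (x + lam)) = deriv (\<lambda>x. f (x + lam))"
    using higher_deriv_shift[OF hol, of 1] by simp
  have dh: "deriv (\<lambda>x. f (x + lam)) holomorphic_on UNIV"
    using entire_higher_deriv[OF g, of 1] by simp
  have "(deriv ^^ s) (\<lambda>x. lam ^ q * deriv f (x + lam) + bcoef lam gam q * f (x + lam)) x
     = lam ^ q * (deriv ^^ s) (\<lambda>x. deriv f (x + lam)) x + bcoef lam gam q * (deriv ^^ s) (\<lambda>x. f (x + lam)) x"
    by (subst higher_deriv_lincomb2) (use g dh dg in auto)
  also have "(deriv ^^ s) (\<lambda>x. deriv f (x + lam)) x = ?F (Suc s)"
    using higher_deriv_shift[OF hol, of "Suc s" lam] by (simp add: dg funpow_swap1)
  also have "(deriv ^^ s) (\<lambda>x. f (x + lam)) x = ?F s"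
    using higher_deriv_shift[OF hol, of s lam] by simp
  finally have L: "(deriv ^^ s) ((L0_fun r a ^^ q) (\<lambda>x. deriv f (x + lam) + gam * f (x + lam))) x =
      lam ^ q * ?F (Suc s) + bcoef lam gam q * ?F s"
    by (simp add: L0_fun_pow_darboux[OF f])
  have "?F (Suc s) = (\<Sum>k<r. poly (if Suc s < r then (if k = Suc s then 1 else 0)
        else (if k = 0 then [:lam, 1:] else 0) + (if k \<in> {1..r-2} then [:a k:] else 0)) x * ?F k)"
  proof (cases "Suc s < r")
    case True
    have "(\<Sum>k<r. poly (if k = Suc s then 1 else 0) x * ?F k) = (\<Sum>k<r. if k = Suc s then ?F k else 0)"
      by (intro sum.cong) auto
    thus ?thesis using True by (simp del: funpow.simps)
  next
    case False
    hence "Suc s = r" using s by simp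
    hence "?F (Suc s) = (x + lam) * f (x + lam) + (\<Sum>k\<in>{1..r-2}. a k * ?F k)"
      using f by (simp add: in_ker_L0_def del: funpow.simps)
    also have "(\<Sum>k\<in>{1..r-2}. a k * ?F k) = (\<Sum>k<r. if k \<in> {1..r-2} then a k * ?F k else 0)"
      using s by (intro sum.mono_neutral_cong_left) auto
    also have "(x + lam) * f (x + lam) = (\<Sum>k<r. if k = 0 then (x + lam) * ?F k else 0)"
      using s by simp
    also have "\<dots> + (\<Sum>k<r. if k \<in> {1..r-2} then a k * ?F k else 0) = 
       (\<Sum>k<r. poly ((if k = 0 then [:lam, 1:] else 0) + (if k \<in> {1..r-2} then [:a k:] else 0)) x * ?F k)"
      unfolding sum.distrib [symmetric] by (intro sum.cong) (auto simp: algebra_simps)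
    finally show ?thesis using False by (simp del: funpow.simps)
  qed
  moreover have "?F s = (\<Sum>k<r. if k = s then ?F k else 0)" using s by simp
  ultimately have "lam ^ q * ?F (Suc s) + bcoef lam gam q * ?F s =
     (\<Sum>k<r. lam ^ q * (poly (if Suc s < r then (if k = Suc s then 1 else 0)
        else (if k = 0 then [:lam, 1:] else 0) + (if k \<in> {1..r-2} then [:a k:] else 0)) x * ?F k)
       + bcoef lam gam q * (if k = s then ?F k else 0))"
    by (simp only: sum.distrib sum_distrib_left)
  also have "\<dots> = (\<Sum>k<r. poly (qentry r a lam gam q s k) x * ?F k)"
    by (intro sum.cong refl) (auto simp: qentry_def algebra_simps)
  finally show ?thesis using L by simp
qed

section \<open>Determinants\<close>

lemma det_nat_eq_det: "det_nat m A = det (mat m m (\<lambda>(i, j). A i j))"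
proof -
  have "p i < m" if "p permutes {..<m}" "i < m" for p i
    using permutes_in_image[OF that(1), of i] that(2) by simp
  thus ?thesis
    by (auto simp: det_nat_def Determinant.det_def atLeast0LessThan intro!: sum.cong prod.cong)
qed

lemma coeff_prod_top:
  fixes p :: "'i \<Rightarrow> 'a :: comm_semiring_1 poly"
  assumes "finite S" "\<And>i. i \<in> S \<Longrightarrow> degree (p i) \<le> d i"
  shows "degree (\<Prod>i\<in>S. p i) \<le> (\<Sum>i\<in>S. d i)"
    and "coeff (\<Prod>i\<in>S. p i) (\<Sum>i\<in>S. d i) = (\<Prod>i\<in>S. coeff (p i) (d i))"
  using assms
proof (induction S rule: finite_induct)
  case (insert i S)
  case 1
  show ?case using insert 1 degree_mult_le[of "p i" "\<Prod>i\<in>S. p i"]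
    by (auto intro: order.trans add_mono)
  case 2
  show ?case using insert 2
    by (simp add: coeff_mult_top)
qed auto

text \<open>Each product in the Leibniz expansion takes one entry from every row, so row bounds add
  up, and the top coefficient is the determinant of the row-wise top coefficients.\<close>

lemma coeff_det_top:
  fixes A :: "'a :: comm_ring_1 poly mat"
  assumes A: "A \<in> carrier_mat n n" and d: "\<And>i j. i < n \<Longrightarrow> j < n \<Longrightarrow> degree (A $$ (i, j)) \<le> d i"
  shows "degree (det A) \<le> (\<Sum>i<n. d i)"
    and "coeff (det A) (\<Sum>i<n. d i) = det (mat n n (\<lambda>(i, j). coeff (A $$ (i, j)) (d i)))"
proof -
  have p: "p i < n" if "p permutes {..<n}" "i < n" for p i
    using permutes_in_image[OF that(1), of i] that(2) by simp
  have eq: "det A = (\<Sum>p | p permutes {..<n}. smult (of_int (sign p)) (\<Prod>i<n. A $$ (i, p i)))"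
    unfolding Determinant.det_def'[OF A] by (simp add: atLeast0LessThan of_int_poly)
  show "degree (det A) \<le> (\<Sum>i<n. d i)"
    unfolding eq using d p
    by (intro degree_sum_le)
       (auto simp: finite_permutations intro!: order.trans[OF degree_smult_le] coeff_prod_top)
  show "coeff (det A) (\<Sum>i<n. d i) = det (mat n n (\<lambda>(i, j). coeff (A $$ (i, j)) (d i)))"
  proof -
    have "coeff (\<Prod>i<n. A $$ (i, q i)) (\<Sum>i<n. d i) = (\<Prod>i<n. coeff (A $$ (i, q i)) (d i))"
      if "q permutes {..<n}" for q
      using d p[OF that] by (intro coeff_prod_top) auto
    thus ?thesis
      unfolding eq coeff_sum using p
      by (auto simp: Determinant.det_def atLeast0LessThan intro!: sum.cong prod.cong)
  qed
qed

lemma poly_det: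
  assumes "A \<in> carrier_mat n n"
  shows "poly (det A) x = det (mat n n (\<lambda>(i, j). poly (A $$ (i, j)) x))"
proof -
  have "p i < n" if "p permutes {..<n}" "i < n" for p i
    using permutes_in_image[OF that(1), of i] that(2) by simp
  moreover have "dim_row A = n" "dim_col A = n" using assms by auto
  ultimately show ?thesis
    by (auto simp: Determinant.det_def atLeast0LessThan poly_sum poly_prod of_int_poly
         intro!: sum.cong prod.cong)
qed

section \<open>Matrices with a variable last column, block matrices and Vandermonde systems\<close>

definition last_col_mat :: "nat \<Rightarrow> (nat \<Rightarrow> nat \<Rightarrow> 'a) \<Rightarrow> (nat \<Rightarrow> 'a) \<Rightarrow> 'a mat" where
  "last_col_mat N Q w = mat (Suc N) (Suc N) (\<lambda>(i, j). if j < N then Q i j else w i)"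

lemma last_col_mat_carrier [simp]: "last_col_mat N Q w \<in> carrier_mat (Suc N) (Suc N)"
  by (simp add: last_col_mat_def)

text \<open>Expansion along the last column. Each cofactor is kept as a full-size determinant with a
  unit last column, so that degree bounds by rows apply to it.\<close>

lemma det_last_col_mat:
  fixes Q :: "nat \<Rightarrow> nat \<Rightarrow> 'a :: comm_ring_1"
  shows "det (last_col_mat N Q w) = (\<Sum>i\<le>N. w i * det (last_col_mat N Q (\<lambda>i'. if i' = i then 1 else 0)))"
proof -
  \<comment> \<open>A cofactor of the last column deletes that column and so does not see
    \<open>w\<close>.\<close>
  have cof: "cofactor (last_col_mat N Q w) i N = cofactor (last_col_mat N Q w') i N" for w w' i
  proof -
    have "mat_delete (last_col_mat N Q w) i N = mat_delete (last_col_mat N Q w') i N"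
      by (rule eq_matI) (auto simp: mat_delete_def last_col_mat_def)
    thus ?thesis by (simp add: cofactor_def)
  qed
  have entry: "last_col_mat N Q w $$ (i, N) = w i" if "i \<le> N" for i w
    using that by (simp add: last_col_mat_def)
  have lap: "det (last_col_mat N Q w) = (\<Sum>i\<le>N. w i * cofactor (last_col_mat N Q (\<lambda>_. 0)) i N)" for w
    by (subst laplace_expansion_column[of _ "Suc N" N])
       (auto simp: lessThan_Suc_atMost cof[of w _ "\<lambda>_. 0"] entry intro!: sum.cong)
  have "det (last_col_mat N Q (\<lambda>i'. if i' = i then 1 else 0)) = cofactor (last_col_mat N Q (\<lambda>_. 0)) i N" (is "_ = ?c i") if "i \<le> N" for i
    using that unfolding lap by (simp add: if_distrib [of "\<lambda>x. x * _"] cong: if_cong)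
  thus ?thesis by (subst lap) simp
qed

text \<open>Index \<open>c = i * r + k\<close> stands for position \<open>k\<close> in block
  \<open>i\<close>; the induction splits off the last block.\<close>

lemma det_block_diag:
  fixes F :: "nat \<Rightarrow> nat \<Rightarrow> nat \<Rightarrow> 'a :: idom"
  assumes "r > 0"
  shows "det (mat (r * n) (r * n) (\<lambda>(c, c'). if c div r = c' div r then F (c div r) (c mod r) (c' mod r) else 0))
    = (\<Prod>i<n. det (mat r r (\<lambda>(k, j). F i k j)))"
proof (induction n)
  case (Suc n)
  let ?M = "\<lambda>n. mat (r * n) (r * n) (\<lambda>(c, c'). if c div r = c' div r then F (c div r) (c mod r) (c' mod r) else 0)"
  let ?D = "mat r r (\<lambda>(k, j). F n k j)"
  have lt: "c div r < n \<longleftrightarrow> c < r * n" for c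
    using assms by (simp add: div_less_iff_less_mult mult.commute)
  have ge: "c div r = n" "c mod r = c - r * n" if "c \<ge> r * n" "c < r * Suc n" for c
  proof -
    show *: "c div r = n" using that assms by (intro div_nat_eqI) (auto simp: mult.commute)
    show "c mod r = c - r * n" using * by (simp add: minus_mult_div_eq_mod [symmetric])
  qed
  have "?M (Suc n) = four_block_mat (?M n) (0\<^sub>m (r * n) r) (0\<^sub>m r (r * n)) ?D"
  proof (rule eq_matI)
    fix c c' assume "c < dim_row (four_block_mat (?M n) (0\<^sub>m (r * n) r) (0\<^sub>m r (r * n)) ?D)"
      "c' < dim_col (four_block_mat (?M n) (0\<^sub>m (r * n) r) (0\<^sub>m r (r * n)) ?D)"
    hence c: "c < r * Suc n" "c' < r * Suc n" by (auto simp: algebra_simps)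
    show "?M (Suc n) $$ (c, c') = four_block_mat (?M n) (0\<^sub>m (r * n) r) (0\<^sub>m r (r * n)) ?D $$ (c, c')"
    proof (cases "c < r * n"; cases "c' < r * n")
      assume "c < r * n" "\<not> c' < r * n"
      thus ?thesis using c lt[of c] ge[of c'] by (auto simp: algebra_simps)
    next
      assume "\<not> c < r * n" "c' < r * n"
      thus ?thesis using c lt[of c'] ge[of c] by (auto simp: algebra_simps)
    next
      assume "\<not> c < r * n" "\<not> c' < r * n"
      thus ?thesis using c ge[of c] ge[of c'] by (auto simp: algebra_simps)
    qed (use c in \<open>auto simp: algebra_simps\<close>)
  qed (auto simp: algebra_simps)
  hence "det (?M (Suc n)) = det (?M n) * det ?D"
    by (simp only:) (rule det_four_block_mat_lower_left_zero, auto)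
  thus ?case using Suc by simp
qed simp

lemma det_bordered:
  fixes G :: "nat \<Rightarrow> nat \<Rightarrow> 'a :: idom"
  shows "det (mat (Suc N) (Suc N) (\<lambda>(i, j). if i < N \<and> j < N then G i j else if i = j then 1 else 0))
    = det (mat N N (\<lambda>(i, j). G i j))"
proof -
  have "mat (Suc N) (Suc N) (\<lambda>(i, j). if i < N \<and> j < N then G i j else if i = j then 1 else 0)
     = four_block_mat (mat N N (\<lambda>(i, j). G i j)) (0\<^sub>m N 1) (0\<^sub>m 1 N) (1\<^sub>m 1)"
    by (rule eq_matI) auto
  thus ?thesis
    by (simp only:) (subst det_four_block_mat_lower_left_zero, auto)
qed

lemma det_mult_fun:
  fixes A B :: "nat \<Rightarrow> nat \<Rightarrow> 'a :: comm_ring_1"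
  shows "det (mat m m (\<lambda>(i, j). \<Sum>k<m. A i k * B k j)) =
    det (mat m m (\<lambda>(i, j). A i j)) * det (mat m m (\<lambda>(i, j). B i j))"
proof -
  have "mat m m (\<lambda>(i, j). \<Sum>k<m. A i k * B k j) = mat m m (\<lambda>(i, j). A i j) * mat m m (\<lambda>(i, j). B i j)"
    by (rule eq_matI) (auto simp: scalar_prod_def atLeast0LessThan)
  thus ?thesis by (simp add: det_mult[of _ m])
qed

lemma sum_div_mod:
  fixes g :: "nat \<Rightarrow> nat \<Rightarrow> 'a :: comm_monoid_add"
  assumes "r > 0"
  shows "(\<Sum>c<r*n. g (c div r) (c mod r)) = (\<Sum>i<n. \<Sum>k<r. g i k)"
proof -
  have "(\<Sum>c<r*n. g (c div r) (c mod r)) = (\<Sum>i<n. \<Sum>c\<in>{i*r..<i*r+r}. g (c div r) (c mod r))"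
    by (simp add: sum.nat_group mult.commute)
  also have "(\<Sum>i<n. \<Sum>c\<in>{i*r..<i*r+r}. g (c div r) (c mod r)) = (\<Sum>i<n. \<Sum>k<r. g i k)"
  proof (rule sum.cong [OF refl])
    fix i show "(\<Sum>c\<in>{i*r..<i*r+r}. g (c div r) (c mod r)) = (\<Sum>k<r. g i k)"
    using sum.shift_bounds_nat_ivl[of "\<lambda>c. g (c div r) (c mod r)" 0 "i*r" r] assms
    by (simp add: atLeast0LessThan add.commute)
  qed
  finally show ?thesis .
qed

text \<open>Combining the equations with the coefficients of the polynomial that vanishes at every
  node but \<open>lam i\<close> isolates \<open>v i\<close>; its degree is below
  \<open>n\<close>.\<close>

lemma vandermonde_kernel:
  fixes lam v :: "nat \<Rightarrow> 'a :: field"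
  assumes inj: "inj_on lam {..<n}" and eq: "\<And>q. q < n \<Longrightarrow> (\<Sum>i<n. lam i ^ q * v i) = 0" and i: "i < n"
  shows "v i = 0"
proof -
  define p where "p = (\<Prod>j\<in>{..<n} - {i}. [:- lam j, 1:])"
  have "degree p \<le> (\<Sum>j\<in>{..<n} - {i}. 1)"
    unfolding p_def by (rule degree_prod_sum_le[THEN order.trans]) auto
  hence deg: "degree p < n" using i by simp
  have "(\<Sum>j<n. poly p (lam j) * v j) = (\<Sum>q\<le>degree p. coeff p q * (\<Sum>j<n. lam j ^ q * v j))"
    unfolding poly_altdef sum_distrib_left sum_distrib_right
    by (subst sum.swap) (simp add: mult_ac)
  also have "\<dots> = 0" using deg by (intro sum.neutral) (auto simp: eq)
  also have "(\<Sum>j<n. poly p (lam j) * v j) = (\<Sum>j<n. if j = i then poly p (lam i) * v i else 0)"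
    by (intro sum.cong refl) (auto simp: p_def poly_prod prod_zero_iff)
  finally have "poly p (lam i) * v i = 0" using i by simp
  moreover have "poly p (lam i) \<noteq> 0"
    using inj i by (auto simp: p_def poly_prod inj_on_def)
  ultimately show ?thesis by simp
qed

section \<open>Leading coefficients of the minors\<close>

text \<open>Row \<open>q * r + s\<close> belongs to \<open>d^s L0^q\<close>, column \<open>i * r + k\<close> to \<open>d^k f(x + lam i)\<close>.\<close>

definition qmat :: "nat \<Rightarrow> (nat \<Rightarrow> complex) \<Rightarrow> (nat \<Rightarrow> complex) \<Rightarrow> (nat \<Rightarrow> complex) \<Rightarrow> nat \<Rightarrow> nat \<Rightarrow> complex poly" where
  "qmat r a lam gam \<rho> c = qentry r a (lam (c div r)) (gam (c div r)) (\<rho> div r) (\<rho> mod r) (c mod r)"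

text \<open>The signed minor m_(q,s) for \<open>\<rho> = q * r + s\<close>.\<close>

definition qminor :: "nat \<Rightarrow> nat \<Rightarrow> (nat \<Rightarrow> complex) \<Rightarrow> (nat \<Rightarrow> complex) \<Rightarrow> (nat \<Rightarrow> complex) \<Rightarrow> nat \<Rightarrow> complex poly" where
  "qminor n r a lam gam \<rho> = det (last_col_mat (r * n) (qmat r a lam gam) (\<lambda>i. if i = \<rho> then 1 else 0))"

definition row_deg :: "nat \<Rightarrow> nat \<Rightarrow> nat" where
  "row_deg r \<rho> = (if \<rho> mod r = r - 1 then 1 else 0)"

text \<open>Row-wise leading coefficients of the matrix behind \<open>qminor\<close>. In rows of
  degree one the last column becomes zero, since its entries are constants.\<close>

definition lead_mat :: "nat \<Rightarrow> nat \<Rightarrow> (nat \<Rightarrow> complex) \<Rightarrow> (nat \<Rightarrow> complex) \<Rightarrow> (nat \<Rightarrow> complex) \<Rightarrow> nat \<Rightarrow> complex mat" where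
  "lead_mat n r a lam gam \<rho> = last_col_mat (r * n)
     (\<lambda>i c. coeff (qmat r a lam gam i c) (row_deg r i))
     (\<lambda>i. coeff (if i = \<rho> then 1 else 0) (row_deg r i))"

text \<open>Each \<open>q < n\<close> gives one row with residue \<open>r - 1\<close>; the extra row
  \<open>r * n\<close> has residue \<open>0\<close>, which differs from
  \<open>r - 1\<close>.\<close>

lemma sum_row_deg:
  assumes "r > 1"
  shows "(\<Sum>\<rho><Suc (r * n). row_deg r \<rho>) = n"
proof -
  have "(\<Sum>\<rho><r*n. row_deg r \<rho>) = (\<Sum>q<n. \<Sum>s<r. if s = r - 1 then 1 else 0)"
    unfolding row_deg_def using assms
    by (subst sum_div_mod [of r "\<lambda>_ s. if s = r - 1 then 1 else 0" n, symmetric]) auto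
  also have "\<dots> = n" using assms by simp
  finally show ?thesis using assms by (simp add: row_deg_def)
qed

lemma degree_qentry: "degree (qentry r a l g q s k) \<le> (if Suc s < r then 0 else 1)"
  unfolding qentry_def by (auto intro!: degree_add_le)

lemma qminor_top:
  assumes r: "r > 1"
  shows "degree (qminor n r a lam gam \<rho>) \<le> n"
    and "coeff (qminor n r a lam gam \<rho>) n = det (lead_mat n r a lam gam \<rho>)"
proof -
  let ?A = "last_col_mat (r * n) (qmat r a lam gam) (\<lambda>i. if i = \<rho> then 1 else 0)"
  have d: "degree (?A $$ (i, j)) \<le> row_deg r i" if "i < Suc (r * n)" "j < Suc (r * n)" for i j
  proof -
    have "i mod r < r" using r by simp
    hence "(if Suc (i mod r) < r then 0 else 1) = row_deg r i"
      by (auto simp: row_deg_def)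
    thus ?thesis
      using that degree_qentry[of r a "lam (j div r)" "gam (j div r)" "i div r" "i mod r" "j mod r"]
      by (auto simp: last_col_mat_def qmat_def)
  qed
  have L: "lead_mat n r a lam gam \<rho> = mat (Suc (r*n)) (Suc (r*n)) (\<lambda>(i, j). coeff (?A $$ (i, j)) (row_deg r i))"
    unfolding lead_mat_def by (rule eq_matI) (auto simp: last_col_mat_def)
  show "degree (qminor n r a lam gam \<rho>) \<le> n"
    unfolding qminor_def using coeff_det_top(1)[OF last_col_mat_carrier d] sum_row_deg[OF r] by simp
  show "coeff (qminor n r a lam gam \<rho>) n = det (lead_mat n r a lam gam \<rho>)"
    unfolding qminor_def L using coeff_det_top(2)[OF last_col_mat_carrier d] sum_row_deg[OF r] by simp
qed

lemma lead_mat_row: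
  fixes v
  assumes r: "r > 1" and i: "i \<le> r * n" and v: "v \<in> carrier_vec (Suc (r * n))"
  shows "(lead_mat n r a lam gam \<rho> *\<^sub>v v) $ i =
     (\<Sum>j<n. \<Sum>k<r. coeff (qentry r a (lam j) (gam j) (i div r) (i mod r) k) (row_deg r i) * v $ (j * r + k))
     + coeff (if i = \<rho> then 1 else 0) (row_deg r i) * v $ (r * n)"
proof -
  have "(lead_mat n r a lam gam \<rho> *\<^sub>v v) $ i =
     (\<Sum>c<r*n. coeff (qentry r a (lam (c div r)) (gam (c div r)) (i div r) (i mod r) (c mod r)) (row_deg r i) *
         v $ (c div r * r + c mod r)) + coeff (if i = \<rho> then 1 else 0) (row_deg r i) * v $ (r * n)"
    using i v
    by (simp add: lead_mat_def last_col_mat_def scalar_prod_def atLeast0LessThan qmat_def)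
  thus ?thesis
    using r by (subst (asm) sum_div_mod [of r "\<lambda>j k. coeff (qentry r a (lam j) (gam j) (i div r) (i mod r) k) (row_deg r i) *
         v $ (j * r + k)"]) auto
qed

lemma mult_add_less:
  fixes q r n s :: nat
  assumes "q < n" "s < r"
  shows "q * r + s < r * n"
proof -
  have "q * r + s < Suc q * r" using assms by simp
  also have "\<dots> \<le> r * n" using assms by (metis Suc_leI mult.commute mult_le_mono2)
  finally show ?thesis .
qed

text \<open>Taking the coefficient of \<open>x\<close> discards \<open>bcoef\<close>, the
  \<open>a k\<close> and the last column; only \<open>lam^q\<close> at \<open>k = 0\<close>
  survives.\<close>

lemma lead_mat_row_last:
  assumes r: "r > 1" and q: "q < n" and v: "v \<in> carrier_vec (Suc (r * n))"
  shows "(lead_mat n r a lam gam \<rho> *\<^sub>v v) $ (q * r + (r - 1)) = (\<Sum>j<n. lam j ^ q * v $ (j * r))"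
proof -
  have i: "q * r + (r - 1) \<le> r * n"
    using mult_add_less[OF q, of "r - 1" r] r by simp
  have "(q * r + t) div r = q \<and> (q * r + t) mod r = t" if "t < r" for t
    using that by auto
  from this[of "r - 1"] have dm: "(q * r + (r - 1)) div r = q" "(q * r + (r - 1)) mod r = r - 1"
    using r by auto
  have rd: "row_deg r (q * r + (r - 1)) = 1" using dm by (simp add: row_deg_def)
  have "(\<Sum>k<r. coeff (qentry r a (lam j) (gam j) q (r - 1) k) 1 * v $ (j * r + k)) = lam j ^ q * v $ (j * r)" for j
  proof -
    have "(\<Sum>k<r. coeff (qentry r a (lam j) (gam j) q (r - 1) k) 1 * v $ (j * r + k))
      = (\<Sum>k<r. if k = 0 then lam j ^ q * v $ (j * r) else 0)"
      using r by (intro sum.cong) (auto simp: qentry_def)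
    thus ?thesis using r by simp
  qed
  note H = this
  show ?thesis
    unfolding lead_mat_row[OF r i v] dm rd H by simp
qed

text \<open>Bounding \<open>q * r + s\<close> instead of \<open>q\<close> includes the final row,
  \<open>q = n\<close> and \<open>s = 0\<close>.\<close>

lemma lead_mat_row_other:
  assumes r: "r > 1" and q: "q * r + s \<le> r * n" and s: "Suc s < r" and v: "v \<in> carrier_vec (Suc (r * n))"
  shows "(lead_mat n r a lam gam \<rho> *\<^sub>v v) $ (q * r + s) =
    (\<Sum>j<n. lam j ^ q * v $ (j * r + Suc s)) + (\<Sum>j<n. bcoef (lam j) (gam j) q * v $ (j * r + s))
    + (if q * r + s = \<rho> then v $ (r * n) else 0)"
proof -
  have dm: "(q * r + s) div r = q" "(q * r + s) mod r = s"
    using s by auto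
  have rd: "row_deg r (q * r + s) = 0" using dm s by (auto simp: row_deg_def)
  have "(\<Sum>k<r. coeff (qentry r a (lam j) (gam j) q s k) 0 * v $ (j * r + k)) =
     lam j ^ q * v $ (j * r + Suc s) + bcoef (lam j) (gam j) q * v $ (j * r + s)" for j
  proof -
    have "(\<Sum>k<r. coeff (qentry r a (lam j) (gam j) q s k) 0 * v $ (j * r + k))
      = (\<Sum>k<r. (if k = Suc s then lam j ^ q * v $ (j * r + k) else 0)
           + (if k = s then bcoef (lam j) (gam j) q * v $ (j * r + k) else 0))"
      using s by (intro sum.cong) (auto simp: qentry_def)
    thus ?thesis using s by (simp add: sum.distrib)
  qed
  note H = this
  show ?thesis
    unfolding lead_mat_row[OF r q v] dm rd H sum.distrib by simp
qed

section \<open>Kernel and determinant of the leading matrix\<close>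

context
  fixes n r :: nat and a lam gam :: "nat \<Rightarrow> complex"
  assumes r: "r > 1" and inj: "inj_on lam {..<n}"
begin

text \<open>The rows with \<open>s = r - 1\<close> form a Vandermonde system in the components at
  level \<open>k = 0\<close>.\<close>

lemma lead_kernel_0:
  assumes v: "v \<in> carrier_vec (Suc (r * n))" and j: "j < n"
    and "\<And>q. q < n \<Longrightarrow> (lead_mat n r a lam gam \<rho> *\<^sub>v v) $ (q * r + (r - 1)) = 0"
  shows "v $ (j * r) = 0"
proof (rule vandermonde_kernel[OF inj _ j, where v = "\<lambda>j. v $ (j * r)"])
  show "(\<Sum>j<n. lam j ^ q * v $ (j * r)) = 0" if "q < n" for q
    using assms(3)[OF that] by (simp only: lead_mat_row_last[OF r that v])
qed

text \<open>Once level \<open>s\<close> vanishes, the \<open>bcoef\<close> terms drop out and a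
  Vandermonde system for level \<open>Suc s\<close> remains; the condition on \<open>\<rho>\<close>
  keeps the last component of \<open>v\<close> out of these rows.\<close>

lemma lead_kernel_Suc:
  assumes v: "v \<in> carrier_vec (Suc (r * n))" and j: "j < n" and s: "Suc s < r"
    and z: "\<And>j. j < n \<Longrightarrow> v $ (j * r + s) = 0"
    and \<rho>: "\<And>q. q < n \<Longrightarrow> \<rho> \<noteq> q * r + s"
    and eq: "\<And>q. q < n \<Longrightarrow> (lead_mat n r a lam gam \<rho> *\<^sub>v v) $ (q * r + s) = 0"
  shows "v $ (j * r + Suc s) = 0"
proof (rule vandermonde_kernel[OF inj _ j, where v = "\<lambda>j. v $ (j * r + Suc s)"])
  fix q assume q: "q < n"
  have i: "q * r + s \<le> r * n"
    using mult_add_less[OF q, of s r] s by simp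
  show "(\<Sum>j<n. lam j ^ q * v $ (j * r + Suc s)) = 0"
    using eq[OF q] \<rho>[OF q] z by (simp add: lead_mat_row_other[OF r i s v])
qed

text \<open>Row \<open>r * n\<close> of the leading matrix vanishes on every vector annihilated by the rows \<open>q * r\<close>
  and \<open>q * r + (r - 1)\<close>, so the adjugate forces the determinant to be zero.\<close>

lemma det_lead_mat_eq_0:
  assumes \<rho>: "\<rho> mod r \<noteq> 0"
  shows "det (lead_mat n r a lam gam \<rho>) = 0"
proof -
  let ?A = "lead_mat n r a lam gam \<rho>"
  let ?N = "r * n"
  have A: "?A \<in> carrier_mat (Suc ?N) (Suc ?N)" by (simp add: lead_mat_def)
  \<comment> \<open>With this column of the adjugate, \<open>A v\<close> is \<open>det A\<close>
    times the last unit vector, so all rows but the last annihilate \<open>v\<close>.\<close>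
  define v where "v = col (adj_mat ?A) ?N"
  have v: "v \<in> carrier_vec (Suc ?N)"
    using carrier_matD(1)[OF adj_mat(1)[OF A]] by (intro carrier_vecI) (simp add: v_def)
  have Av: "(?A *\<^sub>v v) $ i = (if i = ?N then det ?A else 0)" if "i \<le> ?N" for i
  proof -
    have "(?A *\<^sub>v v) $ i = (?A * adj_mat ?A) $$ (i, ?N)"
      using that A adj_mat(1)[OF A] by (simp add: v_def)
    thus ?thesis using that by (simp add: adj_mat(2)[OF A])
  qed
  have v0: "v $ (j * r + 0) = 0" if "j < n" for j
  proof -
    have "(?A *\<^sub>v v) $ (q * r + (r - 1)) = 0" if "q < n" for q
      using mult_add_less[OF that, of "r - 1" r] Av[of "q * r + (r - 1)"] r by simp
    thus ?thesis using lead_kernel_0[OF v \<open>j < n\<close>, of \<rho>] by simp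
  qed
  have v1: "v $ (j * r + Suc 0) = 0" if "j < n" for j
  proof (rule lead_kernel_Suc[OF v that _ v0])
    show "\<rho> \<noteq> q * r + 0" for q using \<rho> by auto
    show "(?A *\<^sub>v v) $ (q * r + 0) = 0" if "q < n" for q
      using mult_add_less[OF that, of 0 r] Av[of "q * r"] r by simp
  qed (use r in auto)
  \<comment> \<open>The final row involves only levels \<open>0\<close> and \<open>1\<close>; its
    entry in the last column is zero because \<open>\<rho>\<close> is not a multiple of
    \<open>r\<close>.\<close>
  have "(?A *\<^sub>v v) $ (n * r + 0) = 0"
    using \<rho> r v0 v1 by (subst lead_mat_row_other[OF r _ _ v]) auto
  thus ?thesis using Av[of ?N] by (simp add: mult.commute)
qed

text \<open>A kernel vector vanishes level by level, and then the final row, whose entry in the last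
  column is \<open>1\<close>, kills its last component.\<close>

lemma det_lead_mat_neq_0: "det (lead_mat n r a lam gam (r * n)) \<noteq> 0"
proof
  let ?A = "lead_mat n r a lam gam (r * n)"
  let ?N = "r * n"
  have A: "?A \<in> carrier_mat (Suc ?N) (Suc ?N)" by (simp add: lead_mat_def)
  assume "det ?A = 0"
  then obtain v where v: "v \<in> carrier_vec (Suc ?N)" "v \<noteq> 0\<^sub>v (Suc ?N)" and Av: "?A *\<^sub>v v = 0\<^sub>v (Suc ?N)"
    using det_0_iff_vec_prod_zero[OF A] by blast
  have Av0: "(?A *\<^sub>v v) $ (q * r + s) = 0" if "q < n" "s < r" for q s
    using mult_add_less[OF that] by (simp add: Av)
  have vs: "v $ (j * r + s) = 0" if "j < n" "s < r" for j s
    using that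
  proof (induction s arbitrary: j)
    case 0
    thus ?case using lead_kernel_0[OF v(1), of j ?N] Av0[of _ "r - 1"] r by simp
  next
    case (Suc s)
    show ?case
    proof (rule lead_kernel_Suc[OF v(1) Suc.prems])
      show "v $ (j * r + s) = 0" if "j < n" for j using Suc that by simp
      show "?N \<noteq> q * r + s" if "q < n" for q using mult_add_less[of q n s r] that Suc.prems by simp
      show "(?A *\<^sub>v v) $ (q * r + s) = 0" if "q < n" for q
        using that Suc.prems by (intro Av0) auto
    qed
  qed
  have "(?A *\<^sub>v v) $ (n * r + 0) = v $ ?N"
    using r vs[of _ 0] vs[of _ 1] by (subst lead_mat_row_other[OF r _ _ v(1)]) (auto simp: mult.commute)
  hence vN: "v $ ?N = 0" using Av by (simp add: mult.commute)
  have "v $ c = 0" if "c < ?N" for c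
  proof -
    have "c div r < n" using that r by (simp add: div_less_iff_less_mult mult.commute)
    thus ?thesis using vs[of "c div r" "c mod r"] r by simp
  qed
  hence "v = 0\<^sub>v (Suc ?N)" using vN v(1) by (intro eq_vecI) (auto simp: less_Suc_eq)
  thus False using v(2) by simp
qed

end

section \<open>The Wronskian operator\<close>

text \<open>The operator \<open>d^s L0^q\<close> is monic of order \<open>q * r + s\<close>, so the
  change of rows is a lower triangular matrix with unit diagonal, of determinant one.\<close>

lemma wronsk_eq_det_L0_fun:
  assumes r: "r > 1" and vs: "\<And>v. v \<in> set vs \<Longrightarrow> v holomorphic_on UNIV"
  shows "wronsk vs x = det (mat (length vs) (length vs)
     (\<lambda>(\<rho>, c). (deriv ^^ (\<rho> mod r)) ((L0_fun r a ^^ (\<rho> div r)) (vs ! c)) x))"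
proof -
  define m where "m = length vs"
  define A where "A = (\<lambda>\<rho>. (rmult_L0 r a ^^ (\<rho> div r)) (monom 1 (\<rho> mod r)))"
  define U where "U = (\<lambda>\<rho> k. poly (coeff (A \<rho>) k) x)"
  have A: "degree (A \<rho>) \<le> \<rho>" "coeff (A \<rho>) \<rho> = 1" for \<rho>
    using rmult_L0_pow_top[OF r degree_monom_le[of 1 "\<rho> mod r"], where a = a and q = "\<rho> div r"] by (auto simp: A_def)
  have U0: "U \<rho> k = 0" if "\<rho> < k" for \<rho> k
    using A(1)[of \<rho>] that by (simp add: U_def coeff_eq_0)
  have "det (mat m m (\<lambda>(\<rho>, k). U \<rho> k)) = 1"
  proof (subst det_lower_triangular[of m])
    show "prod_list (diag_mat (mat m m (\<lambda>(\<rho>, k). U \<rho> k))) = 1"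
      by (rule prod_list_neutral) (auto simp: diag_mat_def U_def A)
  qed (auto simp: U0)
  moreover have "(deriv ^^ (\<rho> mod r)) ((L0_fun r a ^^ (\<rho> div r)) (vs ! c)) x = (\<Sum>k<m. U \<rho> k * (deriv ^^ k) (vs ! c) x)"
    if "\<rho> < m" "c < m" for \<rho> c
  proof -
    have "wapply (A \<rho>) (vs ! c) x = (deriv ^^ (\<rho> mod r)) ((L0_fun r a ^^ (\<rho> div r)) (vs ! c)) x"
      using vs[of "vs ! c"] that by (simp add: A_def wapply_rmult_L0_pow wapply_monom m_def)
    moreover have "wapply (A \<rho>) (vs ! c) x = (\<Sum>k\<le>m-1. U \<rho> k * (deriv ^^ k) (vs ! c) x)"
      unfolding U_def using A(1)[of \<rho>] that by (intro wapply_altdef) auto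
    moreover have "{..m-1} = {..<m}" using that by auto
    ultimately show ?thesis by simp
  qed
  hence "mat m m (\<lambda>(\<rho>, c). (deriv ^^ (\<rho> mod r)) ((L0_fun r a ^^ (\<rho> div r)) (vs ! c)) x) =
     mat m m (\<lambda>(\<rho>, c). \<Sum>k<m. U \<rho> k * (deriv ^^ k) (vs ! c) x)"
    by (intro eq_matI) auto
  ultimately show ?thesis
    unfolding wronsk_def det_nat_eq_det m_def [symmetric] by (simp add: det_mult_fun)
qed

lemma concat_map_upt_eq:
  "concat (map (\<lambda>i. map (g i) [0..<r]) [0..<n]) = map (\<lambda>c. g (c div r) (c mod r)) [0..<r * n]"
proof (induction n)
  case (Suc n)
  have "map (\<lambda>c. g (c div r) (c mod r)) [r * n..<r * n + r] = map (g n) [0..<r]"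
    by (rule nth_equalityI) auto
  thus ?case using Suc upt_add_eq_append[of 0 "r * n" r] by (simp add: algebra_simps)
qed simp

lemma phis_eq: "phis n r lam gam f = map (\<lambda>c x. deriv (f (c mod r)) (x + lam (c div r)) +
    gam (c div r) * f (c mod r) (x + lam (c div r))) [0..<r * n]"
  unfolding phis_def by (rule concat_map_upt_eq)

lemma wronsk_phis:
  assumes r: "r > 1"
    and ker: "\<And>j. j < r \<Longrightarrow> in_ker_L0 r a (f j)"
    and wr1: "\<And>x. wronsk (map f [0..<r]) x = 1"
    and u: "u holomorphic_on UNIV"
  shows "wronsk (phis n r lam gam f @ [u]) x =
    (\<Sum>\<rho>\<le>r*n. poly (qminor n r a lam gam \<rho>) x * (deriv ^^ (\<rho> mod r)) ((L0_fun r a ^^ (\<rho> div r)) u) x)"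
proof -
  define N where "N = r * n"
  define vs where "vs = phis n r lam gam f @ [u]"
  define w where "w = (\<lambda>\<rho>. (deriv ^^ (\<rho> mod r)) ((L0_fun r a ^^ (\<rho> div r)) u) x)"
  define F where "F = (\<lambda>i k j. (deriv ^^ k) (f j) (x + lam i))"
  define G where "G = (\<lambda>c c'. if c div r = c' div r then F (c div r) (c mod r) (c' mod r) else 0)"
  \<comment> \<open>Bordering by a corner \<open>1\<close> makes the last column of the product
    equal to \<open>w\<close>, the column coming from \<open>u\<close>.\<close>
  define B where "B = (\<lambda>i j. if i < N \<and> j < N then G i j else if i = j then 1 else 0)"
  define Q where "Q = (\<lambda>i j. poly (qmat r a lam gam i j) x)"
  have vs_nth: "vs ! c = (\<lambda>x. deriv (f (c mod r)) (x + lam (c div r)) + gam (c div r) * f (c mod r) (x + lam (c div r)))"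
    if "c < N" for c
    using that by (simp add: vs_def phis_eq nth_append N_def)
  have vs_last: "vs ! N = u" and len: "length vs = Suc N"
    by (simp_all add: vs_def phis_eq nth_append N_def)
  have hol: "f j holomorphic_on UNIV" if "j < r" for j
    using ker[OF that] by (simp add: in_ker_L0_def)
  have "v holomorphic_on UNIV" if "v \<in> set vs" for v
  proof -
    have shift: "(\<lambda>x. g (x + c)) holomorphic_on UNIV" if "g holomorphic_on UNIV" for g :: "complex \<Rightarrow> complex" and c
      using that by (auto intro!: holomorphic_on_compose_gen [of _ _ g UNIV, unfolded o_def] holomorphic_intros)
    have "deriv (f j) holomorphic_on UNIV" if "j < r" for j
      using entire_higher_deriv[OF hol[OF that], of 1] by simp
    thus ?thesis using that u r hol
      by (auto simp: vs_def phis_eq intro!: holomorphic_intros shift)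
  qed
  hence "wronsk vs x = det (mat (Suc N) (Suc N)
     (\<lambda>(\<rho>, c). (deriv ^^ (\<rho> mod r)) ((L0_fun r a ^^ (\<rho> div r)) (vs ! c)) x))"
    using wronsk_eq_det_L0_fun[OF r, of vs x a] by (simp add: len)
  also have "mat (Suc N) (Suc N) (\<lambda>(\<rho>, c). (deriv ^^ (\<rho> mod r)) ((L0_fun r a ^^ (\<rho> div r)) (vs ! c)) x) =
     mat (Suc N) (Suc N) (\<lambda>(\<rho>, c). \<Sum>k<Suc N. (if k < N then Q \<rho> k else w \<rho>) * B k c)"
  proof (rule eq_matI, goal_cases)
    case (1 \<rho> c)
    show ?case
    proof (cases "c < N")
      case True
      define i where "i = c div r"
      define j where "j = c mod r"
      have i: "i < n" using True r by (simp add: i_def N_def div_less_iff_less_mult mult.commute)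
      have j: "j < r" using r by (simp add: j_def)
      have "(\<Sum>k<Suc N. (if k < N then Q \<rho> k else w \<rho>) * B k c) = (\<Sum>k<N. Q \<rho> k * G k c)"
        using True by (simp add: B_def)
      \<comment> \<open>Splitting the index into block and position shows that only block
        \<open>i\<close> contributes.\<close>
      also have "\<dots> = (\<Sum>c'<r*n. (\<lambda>i' k. poly (qentry r a (lam i') (gam i') (\<rho> div r) (\<rho> mod r) k) x *
          (if i' = i then F i k j else 0)) (c' div r) (c' mod r))"
        unfolding N_def by (intro sum.cong refl) (simp add: Q_def G_def qmat_def i_def j_def)
      also have "\<dots> = (\<Sum>i'<n. \<Sum>k<r. poly (qentry r a (lam i') (gam i') (\<rho> div r) (\<rho> mod r) k) x *
          (if i' = i then F i k j else 0))"
        using r by (intro sum_div_mod) auto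
      also have "\<dots> = (\<Sum>i'<n. if i' = i then \<Sum>k<r. poly (qentry r a (lam i) (gam i) (\<rho> div r) (\<rho> mod r) k) x * F i k j else 0)"
        by (intro sum.cong) auto
      also have "\<dots> = (\<Sum>k<r. poly (qentry r a (lam i) (gam i) (\<rho> div r) (\<rho> mod r) k) x * F i k j)"
        using i by simp
      also have "\<dots> = (deriv ^^ (\<rho> mod r)) ((L0_fun r a ^^ (\<rho> div r)) (vs ! c)) x"
        using r higher_deriv_L0_fun_pow_darboux[OF ker[OF j], of "\<rho> mod r" "\<rho> div r" "lam i" "gam i" x]
        by (simp add: vs_nth[OF True] F_def i_def j_def)
      finally show ?thesis using 1 by simp
    next
      case False
      hence "c = N" using 1 by simp
      thus ?thesis using 1 by (simp add: vs_last B_def w_def)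
    qed
  qed auto
  also have "det \<dots> = det (last_col_mat N Q w) * det (mat (Suc N) (Suc N) (\<lambda>(i, j). B i j))"
    by (simp only: det_mult_fun last_col_mat_def)
  also have "det (mat (Suc N) (Suc N) (\<lambda>(i, j). B i j)) = (\<Prod>i<n. det (mat r r (\<lambda>(k, j). F i k j)))"
    using r unfolding B_def det_bordered unfolding G_def N_def by (intro det_block_diag) auto
  \<comment> \<open>Each block is the Wronskian matrix of the basis at \<open>x + lam i\<close>,
    normalized to determinant one.\<close>
  also have "\<dots> = 1"
  proof (rule prod.neutral, rule ballI)
    fix i
    have "mat r r (\<lambda>(k, j). F i k j) = mat r r (\<lambda>(k, j). (deriv ^^ k) (map f [0..<r] ! j) (x + lam i))"
      by (rule eq_matI) (auto simp: F_def)
    thus "det (mat r r (\<lambda>(k, j). F i k j)) = 1"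
      using wr1[of "x + lam i"] by (simp add: wronsk_def det_nat_eq_det)
  qed
  also have "det (last_col_mat N Q w) * 1 = (\<Sum>\<rho>\<le>N. w \<rho> * det (last_col_mat N Q (\<lambda>i. if i = \<rho> then 1 else 0)))"
    by (subst det_last_col_mat) simp
  also have "\<dots> = (\<Sum>\<rho>\<le>N. poly (qminor n r a lam gam \<rho>) x * w \<rho>)"
  proof (intro sum.cong refl)
    fix \<rho>
    have "poly (qminor n r a lam gam \<rho>) x = det (last_col_mat N Q (\<lambda>i. if i = \<rho> then 1 else 0))"
      unfolding qminor_def poly_det[OF last_col_mat_carrier] N_def
      by (rule arg_cong [where f = det], rule eq_matI) (auto simp: last_col_mat_def Q_def)
    thus "w \<rho> * det (last_col_mat N Q (\<lambda>i. if i = \<rho> then 1 else 0)) = poly (qminor n r a lam gam \<rho>) x * w \<rho>"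
      by simp
  qed
  finally show ?thesis by (simp add: vs_def w_def N_def)
qed

section \<open>The Wronskian operator in normal form and its image under flat\<close>

definition darboux_op :: "nat \<Rightarrow> nat \<Rightarrow> (nat \<Rightarrow> complex) \<Rightarrow> (nat \<Rightarrow> complex) \<Rightarrow> (nat \<Rightarrow> complex) \<Rightarrow> weyl" where
  "darboux_op n r a lam gam =
     (\<Sum>\<rho>\<le>r*n. (rmult_L0 r a ^^ (\<rho> div r)) (monom (qminor n r a lam gam \<rho>) (\<rho> mod r)))"

lemma wapply_darboux_op:
  assumes "u holomorphic_on UNIV"
  shows "wapply (darboux_op n r a lam gam) u x =
    (\<Sum>\<rho>\<le>r*n. poly (qminor n r a lam gam \<rho>) x * (deriv ^^ (\<rho> mod r)) ((L0_fun r a ^^ (\<rho> div r)) u) x)"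
  by (simp add: darboux_op_def wapply_sum wapply_rmult_L0_pow[OF assms] wapply_monom)

text \<open>The summand with index \<open>\<rho>\<close> has order at most \<open>\<rho>\<close>, so
  only the last one reaches \<open>r * n\<close>.\<close>

lemma darboux_op_top:
  assumes r: "r > 1"
  shows "degree (darboux_op n r a lam gam) \<le> r * n"
    and "coeff (darboux_op n r a lam gam) (r * n) = qminor n r a lam gam (r * n)"
proof -
  define S where "S = (\<lambda>\<rho>. (rmult_L0 r a ^^ (\<rho> div r)) (monom (qminor n r a lam gam \<rho>) (\<rho> mod r)))"
  have S: "degree (S \<rho>) \<le> \<rho>" "coeff (S \<rho>) \<rho> = qminor n r a lam gam \<rho>" for \<rho>
    using rmult_L0_pow_top[OF r degree_monom_le[of "qminor n r a lam gam \<rho>" "\<rho> mod r"], where a = a and q = "\<rho> div r"]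
    by (auto simp: S_def)
  show "degree (darboux_op n r a lam gam) \<le> r * n"
    unfolding darboux_op_def S_def [symmetric]
    by (intro degree_sum_le) (auto intro: order.trans[OF S(1)])
  have "coeff (S \<rho>) (r * n) = 0" if "\<rho> < r * n" for \<rho>
    using S(1)[of \<rho>] that by (intro coeff_eq_0) auto
  hence "coeff (darboux_op n r a lam gam) (r * n) = (\<Sum>\<rho>\<le>r*n. if \<rho> = r * n then qminor n r a lam gam \<rho> else 0)"
    unfolding darboux_op_def S_def [symmetric] coeff_sum using S(2) by (intro sum.cong) auto
  thus "coeff (darboux_op n r a lam gam) (r * n) = qminor n r a lam gam (r * n)" by simp
qed

lemma degree_wflat_darboux_op:
  assumes r: "r > 1" and n: "n \<ge> 1" and inj: "inj_on lam {..<n}"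
  shows "degree (wflat r a (darboux_op n r a lam gam)) = r * n"
proof (rule antisym)
  define M where "M = qminor n r a lam gam"
  define S where "S = (\<lambda>\<rho>. smult ([:0, 1:] ^ (\<rho> div r)) ((dmult ^^ (\<rho> mod r)) (eval_L0 r a (M \<rho>))))"
  have eq: "wflat r a (darboux_op n r a lam gam) = (\<Sum>\<rho>\<le>r*n. S \<rho>)"
    by (simp add: darboux_op_def S_def M_def wflat_sum wflat_rmult_L0_pow[OF r] wflat_monom)
  \<comment> \<open>For \<open>s = 0\<close> the summand is \<open>x^q\<close> times a polynomial in
    \<open>L0\<close>, so it contributes a multiple of \<open>x^q\<close> to the coefficient of
    \<open>d^(r n)\<close>.\<close>
  have S0: "degree (S \<rho>) \<le> r * n" "coeff (S \<rho>) (r * n) = monom (coeff (M \<rho>) n) (\<rho> div r)"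
    if "\<rho> mod r = 0" for \<rho>
  proof -
    have M: "degree (M \<rho>) \<le> n" using qminor_top(1)[OF r] by (simp add: M_def)
    show "degree (S \<rho>) \<le> r * n"
      using eval_L0_top(1)[OF r M, of a] that
      by (auto simp: S_def intro!: order.trans[OF degree_smult_le])
    show "coeff (S \<rho>) (r * n) = monom (coeff (M \<rho>) n) (\<rho> div r)"
      using eval_L0_top(2)[OF r M, of a] that
      by (simp add: S_def monom_altdef)
  qed
  \<comment> \<open>For \<open>s > 0\<close> the minor loses its \<open>x^n\<close> term, which
    lowers the order by \<open>r\<close>, more than \<open>d^s\<close> with \<open>s < r\<close>
    restores.\<close>
  have S1: "degree (S \<rho>) < r * n" if "\<rho> mod r \<noteq> 0" for \<rho>
  proof -
    have *: "coeff (M \<rho>) n = 0" "degree (M \<rho>) \<le> n"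
      using qminor_top[OF r, of n a lam gam \<rho>] det_lead_mat_eq_0[OF r inj that, of a gam]
      by (auto simp: M_def)
    have "coeff (M \<rho>) i = 0" if "i > n - 1" for i
      using * that by (cases "i = n") (auto simp: coeff_eq_0)
    hence M: "degree (M \<rho>) \<le> n - 1"
      by (intro degree_le) simp
    have "degree (S \<rho>) \<le> \<rho> mod r + r * (n - 1)"
      unfolding S_def
      by (rule order.trans[OF degree_smult_le coeff_dmult_pow_top(1)[OF eval_L0_top(1)[OF r M]]])
    also have "\<dots> < r + r * (n - 1)" using r by simp
    also have "\<dots> = r * n" using n by (cases n) auto
    finally show ?thesis .
  qed
  show "degree (wflat r a (darboux_op n r a lam gam)) \<le> r * n"
    unfolding eq using S0(1) S1 by (intro degree_sum_le) (auto intro: less_imp_le)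
  \<comment> \<open>Reading off \<open>x^n\<close> separates the remaining multiples of powers of
    \<open>x\<close> and leaves \<open>q = n\<close>.\<close>
  have "coeff (coeff (S \<rho>) (r * n)) n = (if \<rho> = r * n then coeff (M \<rho>) n else 0)" if "\<rho> \<le> r * n" for \<rho>
  proof (cases "\<rho> mod r = 0")
    case True
    then obtain q where "\<rho> = r * q" by auto
    thus ?thesis using S0(2)[OF True] r by auto
  next
    case False
    thus ?thesis using S1[OF False] by (auto simp: coeff_eq_0)
  qed
  hence "coeff (coeff (wflat r a (darboux_op n r a lam gam)) (r * n)) n = coeff (M (r * n)) n"
    unfolding eq coeff_sum by simp
  also have "\<dots> \<noteq> 0"
    using qminor_top(2)[OF r] det_lead_mat_neq_0[OF r inj] by (simp add: M_def)
  finally show "r * n \<le> degree (wflat r a (darboux_op n r a lam gam))"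
    by (intro le_degree) auto
qed

theorem mainTheorem6:
  fixes r n :: nat and a :: "nat \<Rightarrow> complex"
    and f :: "nat \<Rightarrow> complex \<Rightarrow> complex"
    and lam gam :: "nat \<Rightarrow> complex"
  assumes r: "r > 1"
    and ker: "\<And>j. j < r \<Longrightarrow> in_ker_L0 r a (f j)"
    and wr1: "\<And>x. wronsk (map f [0..<r]) x = 1"
    and n: "n \<ge> 1"
    and dist: "inj_on lam {..<n}"
  shows "\<exists>T :: weyl.
     degree T = r * n
   \<and> (\<forall>u x. u holomorphic_on UNIV \<longrightarrow>
          wronsk (phis n r lam gam f @ [u]) x = wapply T u x)
   \<and> degree (coeff T (r * n)) = n
   \<and> (\<exists>!c. c \<noteq> 0 \<and> lead_coeff (coeff (smult [:c:] T) (r * n)) = 1 \<and> degree (coeff (smult [:c:] T) (r * n)) = n)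
   \<and> degree (wflat r a (smult [:inverse (lead_coeff (coeff T (r * n))):] T)) = r * n"
proof -
  define T where "T = darboux_op n r a lam gam"
  define K where "K = coeff T (r * n)"
  have K: "K = qminor n r a lam gam (r * n)"
    using darboux_op_top(2)[OF r] by (simp add: K_def T_def)
  have Kn: "coeff K n \<noteq> 0"
    unfolding K using qminor_top(2)[OF r] det_lead_mat_neq_0[OF r dist] by simp
  have degK: "degree K = n"
    using qminor_top(1)[OF r] Kn by (intro antisym le_degree) (simp_all add: K)
  have "K \<noteq> 0" using Kn by auto
  hence degT: "degree T = r * n"
    using darboux_op_top(1)[OF r] by (intro antisym le_degree) (auto simp: T_def K_def)
  have cK: "coeff (smult [:c:] T) (r * n) = smult c K" for c by (simp add: K_def)
  have "\<exists>!c. c \<noteq> 0 \<and> lead_coeff (coeff (smult [:c:] T) (r * n)) = 1 \<and> degree (coeff (smult [:c:] T) (r * n)) = n"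
  proof (rule ex1I[of _ "inverse (coeff K n)"])
    show "c = inverse (coeff K n)"
      if "c \<noteq> 0 \<and> lead_coeff (coeff (smult [:c:] T) (r * n)) = 1 \<and> degree (coeff (smult [:c:] T) (r * n)) = n" for c
      using that Kn unfolding cK by (auto simp: degK field_simps)
  qed (unfold cK, use Kn degK in auto)
  \<comment> \<open>Flat commutes with constant factors, so normalization preserves the
    order.\<close>
  moreover have "degree (wflat r a (smult [:inverse (lead_coeff K):] T)) = r * n"
    using Kn degree_wflat_darboux_op[OF r n dist] by (simp add: wflat_smult_const degK T_def)
  moreover have "wronsk (phis n r lam gam f @ [u]) x = wapply T u x" if "u holomorphic_on UNIV" for u x
    using wronsk_phis[OF r ker wr1 that] by (simp add: T_def wapply_darboux_op[OF that])
  ultimately show ?thesis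
    using degT degK by (intro exI[of _ T]) (auto simp: K_def)
qed

end
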